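(* Let $\varphi_1:\mathbb{R}^d\to\mathbb{R}\cup\{\infty\}$ and $\varphi_2:\mathbb{R}^d\to\mathbb{R}$ be lower semicontinuous, put $\varphi:=\varphi_1+\varphi_2$, let $F:\mathbb{R}^d\to\mathbb{R}^d$ and let $x_0\in\operatorname{dom}\varphi$. Suppose there is an open set $\Omega\subset\mathbb{R}^d$ such that $\{x\in\mathbb{R}^d:\varphi(x)\le\varphi(x_0)\}\subset\Omega$, $\varphi_1$ is primal lower regular on $\Omega$, $\varphi_2$ is locally Lipschitz on $\Omega$, and $F$ is locally Lipschitz on $\Omega$. Let $x(\cdot)$ be a solution of $$0\in\partial\varphi_1(x(t))+\partial\varphi_2(x(t))+DF(x(t))(\dot x(t))\ \text{ for a.e. } t\in\mathbb{R}_+,\qquad x(0)=x_0 .$$ Let $\omega(x)$ be the set of $z\in\mathbb{R}^d$ for which there is $t_n\to\infty$ with $x(t_n)\to z$, and let $\mathcal{S}:=\{z\in\mathbb{R}^d:0\in\partial\varphi_1(z)+\partial\varphi_2(z)\}$. Then: (a) If $x(\cdot)$ is bounded, then $\omega(x)$ is nonempty, compact and connected. (b) If $x(\cdot)$ is an energetic solution, then $\omega(x)\subset\mathcal{S}$. Moreover, if $x^\ast\in\omega(x)$, there exists a sequence $s_n\to\infty$ such that $x(s_n)\to x^\ast$, $\dot x(s_n)\to0$, $\varphi(x(s_n))\to\varphi(x^\ast)$ and $\operatorname{dist}(0;\partial\varphi_1(x(s_n))+\partial\varphi_2(x(s_n)))\to0$ as $n\to\infty$. In addition, if $x^\ast$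 is an isolated point of $\omega(x)$, then $x(t)\to x^\ast$ as $t\to\infty$.
   Context: $\mathbb{R}^d$ carries the Euclidean norm $\|\cdot\|$ and inner product $\langle\cdot,\cdot\rangle$; $\mathbb{R}_+=[0,\infty)$; $\mathbb{B}_r(x)$ is the open ball; $\operatorname{dom} f=\{x:f(x)<\infty\}$; $\operatorname{dist}(x;S)=\inf_{y\in S}\|x-y\|$. Tangent cone: for $A\subset\mathbb{R}^m$ and $a\in A$, $T_A(a)$ is the set of $v$ for which there exist $t_n>0$, $t_n\to0$, $v_n\to v$ with $a+t_nv_n\in A$ for all $n$. Fréchet normal cone: $\widehat N_A(a)=\{v:\langle v,w\rangle\le0\ \forall w\in T_A(a)\}$. Clarke normal cone: $N_A(a)=\overline{\operatorname{co}}\{v:\exists\, a_n\in A,\ v_n\in\widehat N_A(a_n),\ (a_n,v_n)\to(a,v)\}$. Clarke subdifferential of a lower semicontinuous $f:\mathbb{R}^d\to\mathbb{R}\cup\{\infty\}$ at $x$ with $f(x)<\infty$: $\partial f(x)=\{\zeta:(\zeta,-1)\in N_{\operatorname{epi}f}(x,f(x))\}$, where $\operatorname{epi}f=\{(x,\alpha):f(x)\le\alpha\}$; $\partial f(x)=\emptyset$ if $f(x)=\infty$; $\operatorname{dom}\partial f=\{x:\partial f(x)\ne\emptyset\}$. Primal lower regular (plr): $f$ is plr at $\bar x$ if there are $\varepsilon>0$, $c\ge0$ such that $f$ is lower semicontinuous on $\mathbb{B}_\varepsilon(\bar x)$ and for all $x\in\mathbb{B}_\varepsilon(\bar x)\cap\operatorname{dom}\partial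 f$ and all $\zeta\in\partial f(x)$, $f(y)\ge f(x)+\langle\zeta,y-x\rangle-c(1+\|\zeta\|)\|y-x\|^2$ for all $y\in\mathbb{B}_\varepsilon(\bar x)$. It is plr on an open set if it is plr at each of its points. Graphical derivative: $DF(x)(v)=\{u\in\mathbb{R}^d:(v,u)\in T_{\operatorname{gph}F}(x,F(x))\}$. Solution: $x:\mathbb{R}_+\to\mathbb{R}^d$ is a solution of the system if $x(0)=x_0$, $x$ is absolutely continuous on every compact interval of $\mathbb{R}_+$, and there exist $v,w\in L^2_{\rm loc}(\mathbb{R}_+;\mathbb{R}^d)$ with $v(t)\in\partial\varphi_1(x(t))$, $w(t)\in\partial\varphi_2(x(t))$ and $v(t)+w(t)\in-DF(x(t))(\dot x(t))$ for a.e. $t\in\mathbb{R}_+$. A solution is energetic if there exists $\rho>0$ such that $\rho\int_s^t\|\dot x(\tau)\|^2d\tau\le\varphi(x(s))-\varphi(x(t))$ for all $0\le s<t$. *)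

theory Defs
  imports "HOL-Analysis.Analysis"
begin

text \<open>Functions with values in \<open>\<real> \<union> {\<infinity>}\<close> are rendered as \<open>ereal\<close>-valued functions;
  the value \<open>-\<infinity>\<close> is excluded where such functions are introduced.\<close>

definition eff_dom :: "('a \<Rightarrow> ereal) \<Rightarrow> 'a set" where
  "eff_dom f = {x. f x < \<infinity>}"

definition epi :: "('a \<Rightarrow> ereal) \<Rightarrow> ('a \<times> real) set" where
  "epi f = {(x, \<alpha>). f x \<le> ereal \<alpha>}"

definition lsc_on :: "'a::topological_space set \<Rightarrow> ('a \<Rightarrow> ereal) \<Rightarrow> bool" where
  "lsc_on S f \<longleftrightarrow> (\<forall>x\<in>S. f x \<le> Liminf (at x within S) f)"

text \<open>The extended-real distance: unlike for \<open>infdist\<close>, the distance to the empty set is \<open>\<infinity>\<close>.\<close>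

definition ext_infdist :: "'a::metric_space \<Rightarrow> 'a set \<Rightarrow> ereal" where
  "ext_infdist x S = (INF y\<in>S. ereal (dist x y))"

definition locally_lipschitz_on ::
    "'a::metric_space set \<Rightarrow> ('a \<Rightarrow> 'b::metric_space) \<Rightarrow> bool" where
  "locally_lipschitz_on \<Omega> f \<longleftrightarrow> (\<forall>x\<in>\<Omega>. \<exists>r>0. \<exists>L. L-lipschitz_on (ball x r \<inter> \<Omega>) f)"

definition tangent_cone :: "'b::real_normed_vector set \<Rightarrow> 'b \<Rightarrow> 'b set" where
  "tangent_cone A a = {v. \<exists>(t :: nat \<Rightarrow> real) w.
      (\<forall>n. t n > 0) \<and> t \<longlonglongrightarrow> 0 \<and> w \<longlonglongrightarrow> v \<and> (\<forall>n. a + t n *\<^sub>R w n \<in> A)}"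

definition frechet_normal_cone :: "'b::real_inner set \<Rightarrow> 'b \<Rightarrow> 'b set" where
  "frechet_normal_cone A a = {v. \<forall>w\<in>tangent_cone A a. v \<bullet> w \<le> 0}"

definition clarke_normal_cone :: "'b::real_inner set \<Rightarrow> 'b \<Rightarrow> 'b set" where
  "clarke_normal_cone A a = closure (convex hull {v. \<exists>a' v'.
      (\<forall>n::nat. a' n \<in> A \<and> v' n \<in> frechet_normal_cone A (a' n)) \<and> a' \<longlonglongrightarrow> a \<and> v' \<longlonglongrightarrow> v})"

definition clarke_subdiff :: "('a::real_inner \<Rightarrow> ereal) \<Rightarrow> 'a \<Rightarrow> 'a set" where
  "clarke_subdiff f x = (if f x < \<infinity>
      then {\<zeta>. (\<zeta>, - 1) \<in> clarke_normal_cone (epi f) (x, real_of_ereal (f x))} else {})"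

definition dom_subdiff :: "('a::real_inner \<Rightarrow> ereal) \<Rightarrow> 'a set" where
  "dom_subdiff f = {x. clarke_subdiff f x \<noteq> {}}"

definition plr_at :: "('a::real_inner \<Rightarrow> ereal) \<Rightarrow> 'a \<Rightarrow> bool" where
  "plr_at f xbar \<longleftrightarrow> (\<exists>\<epsilon>>0. \<exists>c\<ge>0. lsc_on (ball xbar \<epsilon>) f \<and>
      (\<forall>x \<in> ball xbar \<epsilon> \<inter> dom_subdiff f. \<forall>\<zeta> \<in> clarke_subdiff f x. \<forall>y \<in> ball xbar \<epsilon>.
         f y \<ge> f x + ereal (\<zeta> \<bullet> (y - x) - c * (1 + norm \<zeta>) * (norm (y - x))\<^sup>2)))"

definition plr_on :: "'a::real_inner set \<Rightarrow> ('a \<Rightarrow> ereal) \<Rightarrow> bool" where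
  "plr_on \<Omega> f \<longleftrightarrow> (\<forall>x\<in>\<Omega>. plr_at f x)"

definition graphical_derivative ::
    "('a::real_normed_vector \<Rightarrow> 'b::real_normed_vector) \<Rightarrow> 'a \<Rightarrow> 'a \<Rightarrow> 'b set" where
  "graphical_derivative F x v = {u. (v, u) \<in> tangent_cone {(y, z). z = F y} (x, F x)}"

definition abs_continuous_on_interval ::
    "real \<Rightarrow> real \<Rightarrow> (real \<Rightarrow> 'a::real_normed_vector) \<Rightarrow> bool" where
  "abs_continuous_on_interval a b x \<longleftrightarrow> (\<forall>\<epsilon>>0. \<exists>\<delta>>0. \<forall>D :: (real \<times> real) set.
      finite D \<and> (\<forall>(s, t)\<in>D. a \<le> s \<and> s < t \<and> t \<le> b) \<and>
      pairwise (\<lambda>p q. disjnt {fst p<..<snd p} {fst q<..<snd q}) D \<and>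
      (\<Sum>(s, t)\<in>D. t - s) < \<delta>
      \<longrightarrow> (\<Sum>(s, t)\<in>D. norm (x t - x s)) < \<epsilon>)"

definition L2_loc :: "(real \<Rightarrow> 'a::euclidean_space) \<Rightarrow> bool" where
  "L2_loc v \<longleftrightarrow> v \<in> borel_measurable (lebesgue_on {0..}) \<and>
      (\<forall>T\<ge>0. integrable (lebesgue_on {0..T}) (\<lambda>t. (norm (v t))\<^sup>2))"

text \<open>Curves on \<open>[0, \<infinity>)\<close> are functions on \<open>real\<close> whose values at negative times are irrelevant;
  accordingly derivatives are taken within \<open>{0..}\<close>. The existence of the derivative almost
  everywhere, automatic for absolutely continuous curves, is part of reading the inclusion.\<close>

definition is_solution ::
    "('a::euclidean_space \<Rightarrow> ereal) \<Rightarrow> ('a \<Rightarrow> real) \<Rightarrow> ('a \<Rightarrow> 'a) \<Rightarrow> 'a \<Rightarrow> (real \<Rightarrow> 'a) \<Rightarrow> bool" where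
  "is_solution \<phi>1 \<phi>2 F x0 x \<longleftrightarrow> x 0 = x0 \<and>
      (\<forall>a b. 0 \<le> a \<and> a \<le> b \<longrightarrow> abs_continuous_on_interval a b x) \<and>
      (\<exists>v w. L2_loc v \<and> L2_loc w \<and>
        (AE t in lebesgue_on {0..}.
           v t \<in> clarke_subdiff \<phi>1 (x t) \<and> w t \<in> clarke_subdiff (\<lambda>y. ereal (\<phi>2 y)) (x t) \<and>
           (\<exists>xdot. (x has_vector_derivative xdot) (at t within {0..}) \<and>
             v t + w t \<in> uminus ` graphical_derivative F (x t) xdot)))"

text \<open>The integral is the \<open>[0, \<infinity>]\<close>-valued one and the inequality is one of extended reals.
  No expression \<open>\<infinity> - \<infinity>\<close> matters when \<open>\<phi> (x 0) < \<infinity>\<close> and \<open>\<phi> > -\<infinity>\<close>: the inequality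
  for \<open>s = 0\<close> then forces \<open>\<phi> (x t) < \<infinity>\<close> for every \<open>t \<ge> 0\<close>.\<close>

definition is_energetic_solution ::
    "('a::euclidean_space \<Rightarrow> ereal) \<Rightarrow> ('a \<Rightarrow> real) \<Rightarrow> ('a \<Rightarrow> 'a) \<Rightarrow> 'a \<Rightarrow> (real \<Rightarrow> 'a) \<Rightarrow> bool" where
  "is_energetic_solution \<phi>1 \<phi>2 F x0 x \<longleftrightarrow> is_solution \<phi>1 \<phi>2 F x0 x \<and>
      (\<exists>\<rho>>0. \<forall>s t. 0 \<le> s \<and> s < t \<longrightarrow>
         ereal \<rho> * enn2ereal (\<integral>\<^sup>+\<tau>. ennreal ((norm (vector_derivative x (at \<tau> within {0..})))\<^sup>2)
                                \<partial>lebesgue_on {s..t})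
         \<le> (\<phi>1 (x s) + ereal (\<phi>2 (x s))) - (\<phi>1 (x t) + ereal (\<phi>2 (x t))))"

definition omega_limit_set :: "(real \<Rightarrow> 'a::topological_space) \<Rightarrow> 'a set" where
  "omega_limit_set x = {z. \<exists>t :: nat \<Rightarrow> real. (\<forall>n. 0 \<le> t n) \<and>
      filterlim t at_top sequentially \<and> (\<lambda>n. x (t n)) \<longlonglongrightarrow> z}"

text \<open>Here \<open>+\<close> is the Minkowski sum of sets.\<close>

definition stationary_set :: "('a::real_inner \<Rightarrow> ereal) \<Rightarrow> ('a \<Rightarrow> real) \<Rightarrow> 'a set" where
  "stationary_set \<phi>1 \<phi>2 = {z. 0 \<in> clarke_subdiff \<phi>1 z + clarke_subdiff (\<lambda>y. ereal (\<phi>2 y)) z}"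

end

theory Submission
  imports Defs
begin

text \<open>The energy decreases along an energetic solution and is bounded below by its value at any
  \<open>\<omega>\<close>-limit point, so \<open>(norm x')\<^sup>2\<close> has vanishing integral over unit time windows. Hence near every
  late time at which the solution is close to \<open>x\<^sup>*\<close> there is one at which it is still close, the
  velocity is small and the inclusion holds. As \<open>F\<close> is Lipschitz near \<open>x\<^sup>*\<close>, the sum of the two
  subgradients is then small as well. The subgradients of \<open>\<phi>2\<close> are bounded by a Lipschitz
  constant, so both sequences of subgradients converge along a subsequence. The graph of the Clarke
  subdifferential need not be closed in general; here it is, for \<open>\<phi>2\<close> by Lipschitz continuity, and
  for \<open>\<phi>1\<close> because the inequality of primal lower regularity passes to the limit and makes the limit
  a proximal subgradient.\<close>

section \<open>Absolutely continuous curves\<close>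

text \<open>The inclusion and the derivative exist only almost everywhere, so the times that witness
  a limit point may miss both and have to be moved. A move inside a unit window costs at most the
  integral of the speed, which the energy controls; this requires the curve to be the integral of
  its derivative, hence the fundamental theorem below. Lower semicontinuity gives
  \<open>\<phi> z \<le> \<phi> (x t)\<close> for every limit point \<open>z\<close> and every
  \<open>t \<ge> 0\<close>. This one inequality bounds the energy from below, makes
  \<open>\<phi>1 z\<close> finite, and puts \<open>z\<close> into \<Omega>, where the local
  hypotheses apply. Closedness of a subdifferential graph can fail in two ways: the values may not
  converge, so that the normals accumulate at another point of the epigraph, or the approximating
  normals may tilt towards the horizontal. For \<phi>2, continuity excludes the first, and the
  second is excluded because all Frechet normals lie in the cone
  \<open>norm (fst v) \<le> - L * snd v\<close>, whose slice at height -1 is bounded. For \<phi>1,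
  convergence of the values is obtained from the regularity inequality tested at the limit point
  itself.\<close>

lemma sum_content_tagged_partial_division:
  assumes p: "p tagged_partial_division_of i"
  shows "(\<Sum>(t, K)\<in>p. measure lborel K) = measure lebesgue (\<Union>(snd ` p))"
proof -
  note P = tagged_partial_division_ofD[OF p]
  have "(\<Sum>(t, K)\<in>p. measure lborel K) = sum (measure lborel \<circ> snd) p"
    by (simp add: case_prod_beta)
  also have "\<dots> = (\<Sum>K\<in>snd ` p. measure lborel K)"
  proof (rule sum.reindex_nontrivial[symmetric])
    show "finite p" by (fact P(1))
    \<comment> \<open>Distinct tags may carry the same set. Non-overlap then forces its interior to
      be empty, so counting it once or twice makes no difference.\<close>
    fix y z assume yz: "y \<in> p" "z \<in> p" "y \<noteq> z" "snd y = snd z"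
    then have "interior (snd y) \<inter> interior (snd z) = {}"
      using P(5)[of "fst y" "snd y" "fst z" "snd z"] by (metis prod.collapse)
    then have "interior (snd y) = {}" using yz by simp
    moreover obtain a b where "snd y = cbox a b"
      using P(4)[of "fst y" "snd y"] yz(1) by (metis prod.collapse)
    ultimately show "measure lborel (snd y) = 0" by (simp add: content_eq_0_interior)
  qed
  also have "\<dots> = (\<Sum>K\<in>snd ` p. measure lebesgue K)"
    by (rule sum.cong) (auto dest!: P(4))
  also have "\<dots> = measure lebesgue (\<Union>(snd ` p))"
    by (rule content_division[OF partial_division_of_tagged_division[OF p]])
  finally show ?thesis .
qed

text \<open>Non-overlapping intervals have disjoint interiors, so the endpoints form an admissible
  family for absolute continuity. The premise \<open>ac\<close> is that property at one fixed pair
  of \<epsilon> and \<delta>.\<close>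

lemma abs_continuous_tagged_variation:
  fixes x :: "real \<Rightarrow> 'a::real_normed_vector"
  assumes ac: "\<And>D. \<lbrakk>finite D; \<forall>(s, t)\<in>D. a \<le> s \<and> s < t \<and> t \<le> b;
        pairwise (\<lambda>p q. disjnt {fst p<..<snd p} {fst q<..<snd q}) D;
        (\<Sum>(s, t)\<in>D. t - s) < \<delta>\<rbrakk> \<Longrightarrow> (\<Sum>(s, t)\<in>D. norm (x t - x s)) < \<epsilon>"
    and p: "p tagged_partial_division_of {a..b}"
    and small: "(\<Sum>(t, K)\<in>p. measure lborel K) < \<delta>"
  shows "(\<Sum>(t, K)\<in>p. norm (x (Sup K) - x (Inf K))) < \<epsilon>"
proof -
  note P = tagged_partial_division_ofD[OF p]
  have K: "\<exists>u v. K = {u..v} \<and> u \<le> v \<and> a \<le> u \<and> v \<le> b \<and> Inf K = u \<and> Sup K = v \<and> measure lborel K = v - u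
      \<and> interior K = {u<..<v}"
    if mem: "(t, K) \<in> p" for t K
  proof -
    obtain u v where uv: "K = {u..v}" using P(4)[OF mem] by auto
    with P(2)[OF mem] have "u \<le> v" by auto
    with P(3)[OF mem] uv show ?thesis by (intro exI[of _ u] exI[of _ v]) auto
  qed
  \<comment> \<open>Absolute continuity speaks of intervals with \<open>s < t\<close>. Degenerate
    ones contribute nothing to either sum and are dropped; this also makes \<open>h\<close>
    injective, since a nonempty open interval is not disjoint from itself.\<close>
  define q where "q = {z\<in>p. Inf (snd z) \<noteq> Sup (snd z)}"
  define h where "h = (\<lambda>z::real \<times> real set. (Inf (snd z), Sup (snd z)))"
  have fin: "finite p" "finite q" using P(1) by (auto simp: q_def)
  have disj: "disjnt {fst (h y)<..<snd (h y)} {fst (h z)<..<snd (h z)}" 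
    if "y \<in> q" "z \<in> q" "y \<noteq> z" for y z
    using P(5)[of "fst y" "snd y" "fst z" "snd z"] K[of "fst y" "snd y"] K[of "fst z" "snd z"] that
    by (auto simp: q_def h_def disjnt_def)
  have ord: "a \<le> fst (h z) \<and> fst (h z) < snd (h z) \<and> snd (h z) \<le> b" if "z \<in> q" for z
    using K[of "fst z" "snd z"] that by (auto simp: q_def h_def)
  have inj: "inj_on h q"
  proof (rule inj_onI, rule ccontr)
    fix y z assume yz: "y \<in> q" "z \<in> q" "h y = h z" "y \<noteq> z"
    then have "{fst (h y)<..<snd (h y)} = {}" using disj[of y z] by (simp add: disjnt_def)
    with ord[OF yz(1)] show False by simp
  qed
  have "(\<Sum>(t, K)\<in>p. norm (x (Sup K) - x (Inf K))) = (\<Sum>z\<in>q. norm (x (snd (h z)) - x (fst (h z))))"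
    unfolding q_def h_def using fin(1)
    by (intro sum.mono_neutral_cong_right) (auto simp: case_prod_beta)
  also have "\<dots> = (\<Sum>(s, t)\<in>h ` q. norm (x t - x s))"
    by (simp add: sum.reindex[OF inj] case_prod_beta)
  also have "\<dots> < \<epsilon>"
  proof (rule ac)
    show "finite (h ` q)" using fin by simp
    show "\<forall>(s, t)\<in>h ` q. a \<le> s \<and> s < t \<and> t \<le> b" using ord by (simp add: case_prod_beta)
    show "pairwise (\<lambda>p q. disjnt {fst p<..<snd p} {fst q<..<snd q}) (h ` q)"
      unfolding pairwise_def using disj by blast
    have "(\<Sum>(s, t)\<in>h ` q. t - s) = (\<Sum>z\<in>q. snd (h z) - fst (h z))"
      by (simp add: sum.reindex[OF inj] case_prod_beta)
    also have "\<dots> = (\<Sum>(t, K)\<in>p. measure lborel K)"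
      unfolding q_def h_def case_prod_beta
    proof (rule sum.mono_neutral_cong_left[OF fin(1)])
      fix z assume "z \<in> {z \<in> p. Inf (snd z) \<noteq> Sup (snd z)}"
      then show "snd (Inf (snd z), Sup (snd z)) - fst (Inf (snd z), Sup (snd z)) = measure lborel (snd z)"
        using K[of "fst z" "snd z"] by auto
    next
      show "\<forall>i\<in>p - {z \<in> p. Inf (snd z) \<noteq> Sup (snd z)}. measure lborel (snd i) = 0"
      proof
        fix i assume "i \<in> p - {z \<in> p. Inf (snd z) \<noteq> Sup (snd z)}"
        then show "measure lborel (snd i) = 0" using K[of "fst i" "snd i"] by auto
      qed
    qed auto
    finally show "(\<Sum>(s, t)\<in>h ` q. t - s) < \<delta>" using small by simp
  qed
  finally show ?thesis .
qed

text \<open>The derivative is integrated in the gauge sense. On tags outside the exceptional set the gauge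
  comes from differentiability; tags inside it are confined to an open set of small measure,
  where absolute continuity bounds the increments.\<close>

theorem fundamental_theorem_of_calculus_abs_continuous:
  fixes x :: "real \<Rightarrow> 'a::euclidean_space"
  assumes ab: "a \<le> b" and ac: "abs_continuous_on_interval a b x" and N: "negligible N"
    and der: "\<And>t. t \<in> {a..b} - N \<Longrightarrow> (x has_vector_derivative g t) (at t within {a..b})"
  shows "(g has_integral x b - x a) {a..b}"
proof -
  \<comment> \<open>With the integrand 0 on \<open>N\<close>, a tag in \<open>N\<close> contributes
    only the increment of \<open>x\<close>. Changing \<open>g\<close> on a negligible set does not
    affect the integral.\<close>
  define f where "f = (\<lambda>t. if t \<in> N then 0 else g t)"
  have "(f has_integral x b - x a) {a..b}"
    unfolding has_integral_real
  proof (intro allI impI)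
    fix e :: real assume "e > 0"
    then have "e / 2 > 0" by simp
    with ac obtain \<delta> where \<delta>: "\<delta> > 0" and "\<forall>D. finite D \<and> (\<forall>(s, t)\<in>D. a \<le> s \<and> s < t \<and> t \<le> b) \<and>
      pairwise (\<lambda>p q. disjnt {fst p<..<snd p} {fst q<..<snd q}) D \<and>
      (\<Sum>(s, t)\<in>D. t - s) < \<delta> \<longrightarrow> (\<Sum>(s, t)\<in>D. norm (x t - x s)) < e / 2"
      unfolding abs_continuous_on_interval_def by blast
    then have ac': "\<And>D. \<lbrakk>finite D; \<forall>(s, t)\<in>D. a \<le> s \<and> s < t \<and> t \<le> b;
        pairwise (\<lambda>p q. disjnt {fst p<..<snd p} {fst q<..<snd q}) D;
        (\<Sum>(s, t)\<in>D. t - s) < \<delta>\<rbrakk> \<Longrightarrow> (\<Sum>(s, t)\<in>D. norm (x t - x s)) < e / 2"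
      by blast
    have Ns: "N \<in> null_sets lebesgue" using N by (simp add: negligible_iff_null_sets)
    obtain U where U: "open U" "N \<subseteq> U" "U - N \<in> lmeasurable" "emeasure lebesgue (U - N) < ennreal \<delta>"
      using sets_lebesgue_outer_open[of N \<delta>] Ns \<delta> by auto
    have Um: "U \<in> lmeasurable"
      using fmeasurable.Un[OF fmeasurableI_null_sets[OF Ns] U(3)] U(2) by (simp add: Un_absorb1)
    have "measure lebesgue U = measure lebesgue (U - N)"
      using Um Ns by (simp add: fmeasurableD measure_Diff_null_set)
    with U(3,4) \<delta> have mU: "measure lebesgue U < \<delta>"
      by (simp add: emeasure_eq_measure2 ennreal_less_iff)
    \<comment> \<open>The summand 1 admits \<open>a = b\<close> and makes \<open>c * (b - a)\<close>
      strictly less than \<open>e / 2\<close>.\<close>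
    define c where "c = e / (2 * (b - a + 1))"
    have c: "c > 0" "c * (b - a) < e / 2"
      using \<open>e > 0\<close> ab by (auto simp: c_def field_simps)
    have "\<forall>t. \<exists>d>0. (t \<in> N \<longrightarrow> ball t d \<subseteq> U) \<and> (t \<in> {a..b} - N \<longrightarrow>
         (\<forall>y\<in>{a..b}. norm (y - t) < d \<longrightarrow> norm (x y - x t - (y - t) *\<^sub>R g t) \<le> c * norm (y - t)))"
    proof
      fix t
      show "\<exists>d>0. (t \<in> N \<longrightarrow> ball t d \<subseteq> U) \<and> (t \<in> {a..b} - N \<longrightarrow>
         (\<forall>y\<in>{a..b}. norm (y - t) < d \<longrightarrow> norm (x y - x t - (y - t) *\<^sub>R g t) \<le> c * norm (y - t)))"
      proof (cases "t \<in> N")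
        case True
        then obtain d where "d > 0" "ball t d \<subseteq> U" using U(1,2) openE by blast
        with True show ?thesis by auto
      next
        case False
        show ?thesis
        proof (cases "t \<in> {a..b}")
          case True
          with False der have "(x has_vector_derivative g t) (at t within {a..b})" by auto
          then have "\<exists>d>0. \<forall>y\<in>{a..b}. norm (y - t) < d \<longrightarrow>
              norm (x y - x t - (y - t) *\<^sub>R g t) \<le> c * norm (y - t)"
            using c(1) unfolding has_vector_derivative_def has_derivative_within_alt by blast
          then show ?thesis using False by blast
        qed (use False in \<open>auto intro: exI[of _ 1]\<close>)
      qed
    qed
    from choice[OF this] obtain d where d: "\<And>t. d t > 0 \<and> (t \<in> N \<longrightarrow> ball t (d t) \<subseteq> U) \<and>
         (t \<in> {a..b} - N \<longrightarrow> (\<forall>y\<in>{a..b}. norm (y - t) < d t \<longrightarrow>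
            norm (x y - x t - (y - t) *\<^sub>R g t) \<le> c * norm (y - t)))"
      by blast
    then have d0: "\<And>t. d t > 0" and dN: "\<And>t. t \<in> N \<Longrightarrow> ball t (d t) \<subseteq> U"
      by blast+
    have dd: "norm (x y - x t - (y - t) *\<^sub>R g t) \<le> c * norm (y - t)"
      if "t \<in> {a..b}" "t \<notin> N" "y \<in> {a..b}" "norm (y - t) < d t" for t y
      using d[of t] that by blast
    show "\<exists>\<gamma>. gauge \<gamma> \<and> (\<forall>\<D>. \<D> tagged_division_of {a..b} \<and> \<gamma> fine \<D> \<longrightarrow>
        norm ((\<Sum>(t, K)\<in>\<D>. measure lborel K *\<^sub>R f t) - (x b - x a)) < e)"
    proof (intro exI[of _ "\<lambda>t. ball t (d t)"] conjI allI impI)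
      show "gauge (\<lambda>t. ball t (d t))" using d0 gauge_ball_dependent by blast
      fix p assume "p tagged_division_of {a..b} \<and> (\<lambda>t. ball t (d t)) fine p"
      then have p: "p tagged_division_of {a..b}" and fine: "(\<lambda>t. ball t (d t)) fine p" by auto
      note P = tagged_division_ofD[OF p]
      define p1 where "p1 = {z\<in>p. fst z \<in> N}"
      define p2 where "p2 = {z\<in>p. fst z \<notin> N}"
      have pp: "p = p1 \<union> p2" "p1 \<inter> p2 = {}" "finite p1" "finite p2"
        using P(1) by (auto simp: p1_def p2_def)
      have tp1: "p1 tagged_partial_division_of {a..b}"
        using p tagged_partial_division_subset[of p "{a..b}" p1]
        by (auto simp: tagged_division_of_def p1_def)
      let ?E = "\<lambda>(t, K). measure lborel K *\<^sub>R f t - (x (Sup K) - x (Inf K))"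
      have "(\<Sum>(t, K)\<in>p1. measure lborel K) = measure lebesgue (\<Union>(snd ` p1))"
        by (rule sum_content_tagged_partial_division[OF tp1])
      also have "\<dots> \<le> measure lebesgue U"
      proof (rule measure_mono_fmeasurable[OF _ _ Um])
        show "\<Union>(snd ` p1) \<subseteq> U" 
        proof (rule Union_least)
          fix K assume "K \<in> snd ` p1"
          then obtain t where "(t, K) \<in> p" "t \<in> N" by (auto simp: p1_def)
          then show "K \<subseteq> U" using fine dN[of t] unfolding fine_def by blast
        qed
        show "\<Union>(snd ` p1) \<in> sets lebesgue"
          using lmeasurable_division[OF partial_division_of_tagged_division[OF tp1]] by auto
      qed
      also note mU
      finally have v: "(\<Sum>(t, K)\<in>p1. norm (x (Sup K) - x (Inf K))) < e / 2"
        using abs_continuous_tagged_variation[OF ac' tp1] by blast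
      have "norm (\<Sum>z\<in>p1. ?E z) \<le> (\<Sum>z\<in>p1. norm (?E z))" by (rule norm_sum)
      also have "\<dots> = (\<Sum>(t, K)\<in>p1. norm (x (Sup K) - x (Inf K)))"
        by (rule sum.cong) (auto simp: p1_def f_def norm_minus_commute)
      finally have e1: "norm (\<Sum>z\<in>p1. ?E z) < e / 2" using v by simp
      have "norm (\<Sum>z\<in>p2. ?E z) \<le> (\<Sum>z\<in>p2. c * measure lborel (snd z))"
      proof (rule sum_norm_le)
        fix z assume "z \<in> p2"
        obtain t K where z: "z = (t, K)" by fastforce
        with \<open>z \<in> p2\<close> have tK: "(t, K) \<in> p" "t \<notin> N" by (auto simp: p2_def)
        obtain u v where uv: "K = {u..v}" using P(4)[OF tK(1)] by auto
        have t: "u \<le> t" "t \<le> v" "t \<in> {a..b}" using P(2,3)[OF tK(1)] uv by auto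
        have uvab: "u \<in> {a..b}" "v \<in> {a..b}" using P(3)[OF tK(1)] uv t by auto
        have "{u..v} \<subseteq> ball t (d t)" using fine tK uv by (auto simp: fine_def)
        moreover have "u \<in> {u..v}" "v \<in> {u..v}" using t by auto
        ultimately have "u \<in> ball t (d t)" "v \<in> ball t (d t)" by blast+
        then have uvd: "norm (u - t) < d t" "norm (v - t) < d t"
          by (auto simp: dist_norm norm_minus_commute)
        \<comment> \<open>The derivative estimate at the tag is applied to both endpoints. As
          \<open>t\<close> lies between them, the two errors add up to a multiple of
          \<open>v - u\<close>, with no loss.\<close>
        have "norm ((v - u) *\<^sub>R g t - (x v - x u)) = norm (x u - x t - (u - t) *\<^sub>R g t - (x v - x t - (v - t) *\<^sub>R g t))"
          by (auto simp: algebra_simps)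
        also have "\<dots> \<le> norm (x u - x t - (u - t) *\<^sub>R g t) + norm (x v - x t - (v - t) *\<^sub>R g t)"
          by (rule norm_triangle_ineq4)
        also have "\<dots> \<le> c * norm (u - t) + c * norm (v - t)"
          using dd[OF t(3) tK(2)] uvab uvd by (intro add_mono) auto
        also have "\<dots> = c * (v - u)" using t by (simp add: algebra_simps)
        finally show "norm (?E z) \<le> c * measure lborel (snd z)"
          using t tK by (simp add: z uv f_def)
      qed
      also have "\<dots> \<le> (\<Sum>z\<in>p. c * measure lborel (snd z))"
        using P(1) c(1) by (intro sum_mono2) (auto simp: p2_def)
      also have "\<dots> = c * (b - a)"
        using additive_content_tagged_division[of p a b] p ab
        by (simp add: sum_distrib_left[symmetric] case_prod_beta)
      finally have e2: "norm (\<Sum>z\<in>p2. ?E z) < e / 2" using c by simp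
      have "(\<Sum>(t, K)\<in>p. measure lborel K *\<^sub>R f t) - (x b - x a) = (\<Sum>z\<in>p. ?E z)"
        using additive_tagged_division_1[OF ab p, of x]
        by (simp add: sum_subtractf case_prod_beta)
      also have "\<dots> = (\<Sum>z\<in>p1. ?E z) + (\<Sum>z\<in>p2. ?E z)"
        unfolding pp(1) by (rule sum.union_disjoint) (use pp in auto)
      finally show "norm ((\<Sum>(t, K)\<in>p. measure lborel K *\<^sub>R f t) - (x b - x a)) < e"
        using norm_triangle_lt[of "\<Sum>z\<in>p1. ?E z" "\<Sum>z\<in>p2. ?E z" e] e1 e2 by simp
    qed
  qed
  then show ?thesis
    by (rule has_integral_spike[OF N, rotated]) (auto simp: f_def)
qed

lemma abs_continuous_increment_le:
  fixes x :: "real \<Rightarrow> 'a::euclidean_space"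
  assumes ab: "a \<le> b" "b \<le> a + 1" and ac: "abs_continuous_on_interval a b x"
    and der: "AE t in lebesgue_on {a..b}. (x has_vector_derivative g t) (at t within {a..b})"
    and \<kappa>: "\<kappa> > 0" and en: "(\<integral>\<^sup>+t. ennreal ((norm (g t))\<^sup>2) \<partial>lebesgue_on {a..b}) \<le> ennreal (\<kappa>\<^sup>2)"
  shows "norm (x b - x a) \<le> \<kappa>"
proof -
  let ?M = "lebesgue_on {a..b}"
  obtain N where N: "N \<in> null_sets ?M"
      "{t \<in> space ?M. \<not> (x has_vector_derivative g t) (at t within {a..b})} \<subseteq> N"
    using der unfolding eventually_ae_filter by blast
  have "negligible N"
    using N(1) by (simp add: null_sets_restrict_space negligible_iff_null_sets)
  then have int: "(g has_integral x b - x a) {a..b}"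
    by (rule fundamental_theorem_of_calculus_abs_continuous[OF ab(1) ac]) (use N(2) in auto)
  have meas[measurable]: "g \<in> borel_measurable ?M"
    using int by (intro integrable_imp_measurable) auto
  \<comment> \<open>Young's inequality takes the place of Cauchy-Schwarz: over an interval of length
    at most 1, each of the two terms integrates to at most \<open>\<kappa> / 2\<close>.\<close>
  have pw: "ennreal (norm (g t)) \<le> ennreal (\<kappa> / 2) + ennreal (1 / (2 * \<kappa>)) * ennreal ((norm (g t))\<^sup>2)" for t
  proof -
    have "0 \<le> (norm (g t) - \<kappa>)\<^sup>2" by simp
    then have "norm (g t) \<le> \<kappa> / 2 + 1 / (2 * \<kappa>) * (norm (g t))\<^sup>2"
      using \<kappa> by (simp add: field_simps power2_eq_square)
    then show ?thesis
      using \<kappa> by (simp add: ennreal_mult[symmetric] ennreal_plus[symmetric] ennreal_leI del: ennreal_plus)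
  qed
  have "(\<integral>\<^sup>+t. ennreal (norm (g t)) \<partial>?M)
      \<le> (\<integral>\<^sup>+t. ennreal (\<kappa> / 2) + ennreal (1 / (2 * \<kappa>)) * ennreal ((norm (g t))\<^sup>2) \<partial>?M)"
    by (intro nn_integral_mono pw)
  also have "\<dots> = ennreal (\<kappa> / 2) * ennreal (b - a)
      + ennreal (1 / (2 * \<kappa>)) * (\<integral>\<^sup>+t. ennreal ((norm (g t))\<^sup>2) \<partial>?M)"
    by (subst nn_integral_add) (simp_all add: nn_integral_cmult emeasure_restrict_space ab(1))
  also have "\<dots> \<le> ennreal (\<kappa> / 2) * ennreal 1 + ennreal (1 / (2 * \<kappa>)) * ennreal (\<kappa>\<^sup>2)"
    using ab en by (intro add_mono mult_left_mono ennreal_leI) auto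
  also have "\<dots> = ennreal (\<kappa> / 2 * 1 + 1 / (2 * \<kappa>) * \<kappa>\<^sup>2)"
    using \<kappa> by (subst (1 2) ennreal_mult[symmetric], simp_all flip: ennreal_plus)
  also have "\<kappa> / 2 * 1 + 1 / (2 * \<kappa>) * \<kappa>\<^sup>2 = \<kappa>"
    using \<kappa> by (simp add: field_simps power2_eq_square)
  finally have le: "(\<integral>\<^sup>+t. ennreal (norm (g t)) \<partial>?M) \<le> ennreal \<kappa>" .
  \<comment> \<open>So far \<open>g\<close> is integrable only in the gauge sense. The finite
    integral of its norm makes it Lebesgue integrable, with the same integral.\<close>
  then have gi: "integrable ?M g"
    by (intro integrableI_bounded meas) (auto intro: le_less_trans)
  have "integral\<^sup>L ?M g = x b - x a"
    using lebesgue_integral_eq_integral[OF gi] integral_unique[OF int] by simp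
  with integral_norm_bound_ennreal[OF gi] le have "ennreal (norm (x b - x a)) \<le> ennreal \<kappa>"
    by simp
  then show ?thesis using \<kappa> by simp
qed

section \<open>Clarke normals and subgradients\<close>

lemma zero_in_frechet_normal_cone [simp]: "0 \<in> frechet_normal_cone A a"
  by (simp add: frechet_normal_cone_def)

lemma frechet_normal_cone_scaleR:
  assumes "v \<in> frechet_normal_cone A a" "c \<ge> 0"
  shows "c *\<^sub>R v \<in> frechet_normal_cone A a"
  using assms by (auto simp: frechet_normal_cone_def mult_nonneg_nonpos)

lemma clarke_normal_coneI:
  assumes "\<And>n::nat. a' n \<in> A" "\<And>n. v' n \<in> frechet_normal_cone A (a' n)" "a' \<longlonglongrightarrow> a" "v' \<longlonglongrightarrow> v"
  shows "v \<in> clarke_normal_cone A a"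
  unfolding clarke_normal_cone_def
  by (rule subsetD[OF closure_subset], rule hull_inc) (use assms in blast)

lemma frechet_subset_clarke_normal_cone:
  assumes "a \<in> A" shows "frechet_normal_cone A a \<subseteq> clarke_normal_cone A a"
  using assms by (auto intro!: clarke_normal_coneI[where a' = "\<lambda>_. a"])

lemma closed_clarke_normal_cone: "closed (clarke_normal_cone A a)"
  by (simp add: clarke_normal_cone_def)

lemma convex_clarke_normal_cone: "convex (clarke_normal_cone A a)"
  by (simp add: clarke_normal_cone_def convex_closure)

lemma clarke_normal_cone_scaleR:
  assumes "v \<in> clarke_normal_cone A a" "c \<ge> 0"
  shows "c *\<^sub>R v \<in> clarke_normal_cone A a"
proof -
  let ?K = "{v. \<exists>a' v'. (\<forall>n::nat. a' n \<in> A \<and> v' n \<in> frechet_normal_cone A (a' n))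
    \<and> a' \<longlonglongrightarrow> a \<and> v' \<longlonglongrightarrow> v}"
  have "(*\<^sub>R) c ` ?K \<subseteq> ?K"
  proof safe
    fix v a' v' assume "\<forall>n::nat. a' n \<in> A \<and> v' n \<in> frechet_normal_cone A (a' n)" "a' \<longlonglongrightarrow> a" "v' \<longlonglongrightarrow> v"
    then show "\<exists>a' v'. (\<forall>n::nat. a' n \<in> A \<and> v' n \<in> frechet_normal_cone A (a' n))
        \<and> a' \<longlonglongrightarrow> a \<and> v' \<longlonglongrightarrow> c *\<^sub>R v"
      using assms(2) by (intro exI[of _ a'] exI[of _ "\<lambda>n. c *\<^sub>R v' n"])
        (auto intro!: frechet_normal_cone_scaleR tendsto_intros)
  qed
  then have "(*\<^sub>R) c ` (convex hull ?K) \<subseteq> convex hull ?K"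
    using hull_mono[of _ _ convex] by (simp add: convex_hull_scaling[symmetric])
  then have "(*\<^sub>R) c ` closure (convex hull ?K) \<subseteq> closure (convex hull ?K)"
    using closure_mono by (simp add: closure_scaleR)
  with assms(1) show ?thesis unfolding clarke_normal_cone_def by blast
qed

text \<open>Approximating normals eventually sit at points of \<open>U\<close>, and a closed convex
  set keeps their limits, convex combinations and closure. Every estimate on Clarke normals below is
  reduced in this way to Frechet normals nearby.\<close>

lemma clarke_normal_cone_subset:
  assumes C: "closed C" "convex C" and U: "open U" "a \<in> U"
    and sub: "\<And>b. b \<in> A \<inter> U \<Longrightarrow> frechet_normal_cone A b \<subseteq> C"
  shows "clarke_normal_cone A a \<subseteq> C"
  unfolding clarke_normal_cone_def
proof (intro closure_minimal hull_minimal)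
  show "{v. \<exists>a' v'. (\<forall>n::nat. a' n \<in> A \<and> v' n \<in> frechet_normal_cone A (a' n))
      \<and> a' \<longlonglongrightarrow> a \<and> v' \<longlonglongrightarrow> v} \<subseteq> C"
  proof safe
    fix v a' v' assume *: "\<forall>n::nat. a' n \<in> A \<and> v' n \<in> frechet_normal_cone A (a' n)" "a' \<longlonglongrightarrow> a" "v' \<longlonglongrightarrow> v"
    have "\<forall>\<^sub>F n in sequentially. a' n \<in> U"
      using topological_tendstoD[OF *(2) U] .
    then have "\<forall>\<^sub>F n in sequentially. v' n \<in> C"
      by (rule eventually_mono) (use * sub in blast)
    then show "v \<in> C" using Lim_in_closed_set[OF C(1) _ _ *(3)] by simp
  qed
qed (use C in auto)

text \<open>An epigraph is closed under moving upwards, so the vertical direction is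
  tangent.\<close>

lemma frechet_normal_epi_snd_nonpos:
  assumes "f a \<le> ereal \<alpha>" and "v \<in> frechet_normal_cone (epi f) (a, \<alpha>)"
  shows "snd v \<le> 0"
proof -
  have "(0, 1) \<in> tangent_cone (epi f) (a, \<alpha>)"
    unfolding tangent_cone_def mem_Collect_eq
  proof (intro exI[of _ "\<lambda>n. inverse (Suc n)"] exI[of _ "\<lambda>_. (0, 1)"] conjI allI)
    show "(\<lambda>n. inverse (real (Suc n))) \<longlonglongrightarrow> 0" by (rule LIMSEQ_inverse_real_of_nat)
    fix n show "(a, \<alpha>) + inverse (Suc n) *\<^sub>R (0, 1) \<in> epi f"
      using assms(1) by (auto simp: epi_def intro: order_trans)
  qed auto
  with assms(2) show ?thesis by (force simp: frechet_normal_cone_def inner_prod_def)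
qed

text \<open>With \<open>h = fst v\<close>, the direction \<open>(h, L * norm h)\<close> is tangent
  because \<open>f\<close> climbs with slope at most \<open>L\<close>. Pairing it with
  \<open>v\<close> and cancelling \<open>norm h\<close> gives the bound. In particular a nonzero
  normal is never horizontal.\<close>

lemma frechet_normal_epi_lipschitz:
  fixes f :: "'a::real_inner \<Rightarrow> real"
  assumes f: "L-lipschitz_on U f" and U: "open U" "a \<in> U" and a: "f a \<le> \<alpha>"
    and v: "v \<in> frechet_normal_cone (epi (\<lambda>y. ereal (f y))) (a, \<alpha>)"
  shows "norm (fst v) \<le> - L * snd v"
proof -
  let ?h = "fst v"
  obtain e where e: "e > 0" "ball a e \<subseteq> U" using U openE by blast
  \<comment> \<open>Scaling by \<open>s\<close> keeps the whole segment inside the ball; the 1 in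
    the denominator covers \<open>h = 0\<close>.\<close>
  define s where "s = e / (norm ?h + 1)"
  have s: "s > 0" "s * norm ?h < e"
    using e by (auto simp: s_def field_simps add_pos_nonneg)
  have "(?h, L * norm ?h) \<in> tangent_cone (epi (\<lambda>y. ereal (f y))) (a, \<alpha>)"
    unfolding tangent_cone_def mem_Collect_eq
  proof (intro exI[of _ "\<lambda>n. s * inverse (Suc n)"] exI[of _ "\<lambda>_. (?h, L * norm ?h)"] conjI allI)
    show "(\<lambda>n. s * inverse (real (Suc n))) \<longlonglongrightarrow> 0"
      using tendsto_mult_left[OF LIMSEQ_inverse_real_of_nat, of s] by simp
    fix n
    show "0 < s * inverse (real (Suc n))" using s by simp
    let ?t = "s * inverse (Suc n)"
    have t: "?t > 0" "?t \<le> s" using s by (auto simp: field_simps)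
    have "?t * norm ?h \<le> s * norm ?h" using t by (intro mult_right_mono) auto
    moreover have "norm (?t *\<^sub>R ?h) = ?t * norm ?h"
      using t by (simp only: norm_scaleR abs_of_pos)
    ultimately have "norm (?t *\<^sub>R ?h) < e" using s by linarith
    then have "a + ?t *\<^sub>R ?h \<in> ball a e" by (simp only: mem_ball dist_norm) simp
    then have "dist (f (a + ?t *\<^sub>R ?h)) (f a) \<le> L * dist (a + ?t *\<^sub>R ?h) a"
      using lipschitz_onD[OF f] e U by blast
    then have "f (a + ?t *\<^sub>R ?h) \<le> \<alpha> + ?t * (L * norm ?h)"
      using a t by (auto simp: dist_norm algebra_simps abs_le_iff)
    then show "(a, \<alpha>) + ?t *\<^sub>R (?h, L * norm ?h) \<in> epi (\<lambda>y. ereal (f y))"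
      by (simp add: epi_def)
  qed auto
  with v have "v \<bullet> (?h, L * norm ?h) \<le> 0" by (simp add: frechet_normal_cone_def)
  then have *: "norm ?h * (norm ?h + L * snd v) \<le> 0"
    by (simp add: inner_prod_def dot_square_norm power2_eq_square algebra_simps)
  have "snd v \<le> 0" using frechet_normal_epi_snd_nonpos[OF _ v] a by simp
  show ?thesis
  \<comment> \<open>For \<open>h = 0\<close> the inequality just obtained is vacuous, and the sign
    of the vertical component decides.\<close>
  proof (cases "?h = 0")
    case True
    with \<open>snd v \<le> 0\<close> lipschitz_on_nonneg[OF f] show ?thesis by (simp add: mult_nonneg_nonpos)
  next
    case False
    with * show ?thesis by (auto simp: mult_le_0_iff)
  qed
qed

text \<open>The bound on Frechet normals describes a closed convex cone, so it survives the passage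
  to Clarke normals; at vertical component -1 it reads \<open>norm \<zeta> \<le> L\<close>.\<close>

lemma clarke_subdiff_lipschitz_bound:
  fixes f :: "'a::euclidean_space \<Rightarrow> real"
  assumes f: "L-lipschitz_on U f" and U: "open U" "x \<in> U"
    and z: "\<zeta> \<in> clarke_subdiff (\<lambda>y. ereal (f y)) x"
  shows "norm \<zeta> \<le> L"
proof -
  have "clarke_normal_cone (epi (\<lambda>y. ereal (f y))) (x, f x) \<subseteq> {v. norm (fst v) + L * snd v \<le> 0}"
  proof (rule clarke_normal_cone_subset[where U = "U \<times> UNIV"])
    show "closed {v::'a \<times> real. norm (fst v) + L * snd v \<le> 0}"
      by (intro closed_Collect_le continuous_intros)
    show "convex {v::'a \<times> real. norm (fst v) + L * snd v \<le> 0}"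
    proof (rule convexI)
      fix v w :: "'a \<times> real" and p q :: real
      assume vw: "v \<in> {v. norm (fst v) + L * snd v \<le> 0}" "w \<in> {v. norm (fst v) + L * snd v \<le> 0}"
        and pq: "0 \<le> p" "0 \<le> q" "p + q = 1"
      have "norm (fst (p *\<^sub>R v + q *\<^sub>R w)) \<le> p * norm (fst v) + q * norm (fst w)"
        using norm_triangle_ineq[of "p *\<^sub>R fst v" "q *\<^sub>R fst w"] pq by simp
      moreover have "p * (norm (fst v) + L * snd v) \<le> 0" "q * (norm (fst w) + L * snd w) \<le> 0"
        using vw pq by (auto intro: mult_nonneg_nonpos)
      ultimately show "p *\<^sub>R v + q *\<^sub>R w \<in> {v. norm (fst v) + L * snd v \<le> 0}"
        by (simp add: algebra_simps)
    qed
    show "open (U \<times> (UNIV::real set))" using U by (simp add: open_Times)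
    fix b assume b: "b \<in> epi (\<lambda>y. ereal (f y)) \<inter> U \<times> UNIV"
    show "frechet_normal_cone (epi (\<lambda>y. ereal (f y))) b \<subseteq> {v. norm (fst v) + L * snd v \<le> 0}"
      using frechet_normal_epi_lipschitz[OF f U(1), of "fst b" "snd b"] b
      by (fastforce simp: epi_def)
  qed (use U in auto)
  with z show ?thesis by (force simp: clarke_subdiff_def)
qed

text \<open>A functional separating \<open>(\<zeta>, -1)\<close> from the Clarke normal cone at \<open>x\<close> is nonpositive on that
  cone. By compactness of the normalized normals it is almost nonpositive on the Frechet normals
  at nearby points, hence on the Clarke normals there. This avoids Caratheodory's theorem.\<close>

theorem clarke_subdiff_lipschitz_closed:
  fixes f :: "'a::euclidean_space \<Rightarrow> real"
  assumes f: "L-lipschitz_on U f" and U: "open U" "x \<in> U"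
    and X: "X \<longlonglongrightarrow> x" and Z: "Z \<longlonglongrightarrow> \<zeta>"
    and mem: "\<And>n. Z n \<in> clarke_subdiff (\<lambda>y. ereal (f y)) (X n)"
  shows "\<zeta> \<in> clarke_subdiff (\<lambda>y. ereal (f y)) x"
proof (rule ccontr)
  let ?f = "\<lambda>y. ereal (f y)"
  let ?C = "clarke_normal_cone (epi ?f) (x, f x)"
  assume "\<zeta> \<notin> clarke_subdiff ?f x"
  then have "(\<zeta>, -1) \<notin> ?C" by (simp add: clarke_subdiff_def)
  then obtain p b where pb: "p \<bullet> (\<zeta>, -1) < b" "\<And>v. v \<in> ?C \<Longrightarrow> p \<bullet> v > b"
    using separating_hyperplane_closed_point[OF convex_clarke_normal_cone closed_clarke_normal_cone]
    by blast
  have "0 \<in> ?C"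
    using frechet_subset_clarke_normal_cone[of "(x, f x)" "epi ?f"] by (auto simp: epi_def)
  from pb(2)[OF this] have "b < 0" by simp
  have pos: "p \<bullet> v \<ge> 0" if "v \<in> ?C" for v
  proof (rule ccontr)
    assume *: "\<not> p \<bullet> v \<ge> 0"
    with \<open>b < 0\<close> have "b / (p \<bullet> v) \<ge> 0" by (simp add: divide_nonpos_neg)
    \<comment> \<open>The scaled vector stays in the cone and has inner product exactly
      \<open>b\<close> with \<open>p\<close>, against strict separation.\<close>
    from pb(2)[OF clarke_normal_cone_scaleR[OF that this]] * show False by simp
  qed
  \<comment> \<open>Half of the gap: the limit argument will give
    \<open>p \<bullet> (\<zeta>, -1) \<ge> b / 2\<close>, which exceeds \<open>b\<close> since
    \<open>b < 0\<close>.\<close>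
  define \<epsilon> where "\<epsilon> = - b / 2"
  have \<epsilon>: "\<epsilon> > 0" using \<open>b < 0\<close> by (simp add: \<epsilon>_def)
  have cont: "isCont f x"
    using lipschitz_on_continuous_on[OF f] U by (simp add: continuous_on_eq_continuous_at)
  have "\<exists>\<delta>>0. \<forall>a\<in>epi ?f \<inter> ball (x, f x) \<delta>. \<forall>v\<in>frechet_normal_cone (epi ?f) a. p \<bullet> v \<ge> \<epsilon> * snd v"
  proof (rule ccontr)
    assume neg: "\<not> ?thesis"
    have "\<exists>a v. a \<in> epi ?f \<and> a \<in> ball (x, f x) (inverse (Suc n)) \<and> v \<in> frechet_normal_cone (epi ?f) a
        \<and> p \<bullet> v < \<epsilon> * snd v" for n :: nat
    proof -
      have "inverse (real (Suc n)) > 0" by simp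
      with neg have "\<not> (\<forall>a\<in>epi ?f \<inter> ball (x, f x) (inverse (Suc n)).
          \<forall>v\<in>frechet_normal_cone (epi ?f) a. p \<bullet> v \<ge> \<epsilon> * snd v)"
        by blast
      then show ?thesis unfolding Ball_def not_all not_imp not_le by blast
    qed
    then have "\<forall>n. \<exists>q. fst q \<in> epi ?f \<and> fst q \<in> ball (x, f x) (inverse (Suc n)) \<and>
        snd q \<in> frechet_normal_cone (epi ?f) (fst q) \<and> p \<bullet> snd q < \<epsilon> * snd (snd q)"
      by auto
    from choice[OF this] obtain q where q: "\<And>n. fst (q n) \<in> epi ?f \<and>
        fst (q n) \<in> ball (x, f x) (inverse (Suc n)) \<and>
        snd (q n) \<in> frechet_normal_cone (epi ?f) (fst (q n)) \<and> p \<bullet> snd (q n) < \<epsilon> * snd (snd (q n))"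
      by blast
    define a where "a = (\<lambda>n. fst (q n))"
    define v where "v = (\<lambda>n. snd (q n))"
    have a: "\<And>n. a n \<in> epi ?f" "\<And>n. a n \<in> ball (x, f x) (inverse (Suc n))"
      and v: "\<And>n. v n \<in> frechet_normal_cone (epi ?f) (a n)" "\<And>n. p \<bullet> v n < \<epsilon> * snd (v n)"
      using q by (auto simp: a_def v_def simp del: of_nat_Suc mem_ball)
    have alim: "a \<longlonglongrightarrow> (x, f x)"
    proof (rule metric_tendsto_imp_tendsto[OF LIMSEQ_inverse_real_of_nat])
      show "\<forall>\<^sub>F n in sequentially. dist (a n) (x, f x) \<le> dist (inverse (real (Suc n))) 0"
        using a(2) by (auto simp: dist_commute less_imp_le intro!: always_eventually)
    qed
    have "(\<lambda>n. fst (a n)) \<longlonglongrightarrow> x" using tendsto_fst[OF alim] by simp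
    from topological_tendstoD[OF this U] obtain N where N: "\<And>n. n \<ge> N \<Longrightarrow> fst (a n) \<in> U"
      by (auto simp: eventually_sequentially)
    have bd: "norm (fst (v n)) \<le> - L * snd (v n)" if "n \<ge> N" for n
      using frechet_normal_epi_lipschitz[OF f U(1) N[OF that], of "snd (a n)" "v n"] a(1)[of n] v(1)[of n]
      by (simp add: epi_def case_prod_beta)
    have neg: "snd (v n) < 0" if "n \<ge> N" for n
    proof -
      have "snd (v n) \<le> 0"
        using frechet_normal_epi_snd_nonpos[of ?f "fst (a n)" "snd (a n)" "v n"] a(1)[of n] v(1)[of n]
        by (simp add: epi_def case_prod_beta)
      moreover have "snd (v n) \<noteq> 0"
      proof
        assume "snd (v n) = 0"
        with bd[OF that] have "v n = 0" by (simp add: prod_eq_iff)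
        with v(2)[of n] show False by simp
      qed
      ultimately show ?thesis by simp
    qed
    \<comment> \<open>Normals are rescaled to vertical component -1. The factor is positive, so they
      remain normals, the bound becomes \<open>norm (fst (w n)) \<le> L\<close>, and the violated
      inequality becomes a uniform gap \<open>p \<bullet> w n < - \<epsilon>\<close> that a limit
      cannot lose.\<close>
    define w where "w = (\<lambda>n. (- inverse (snd (v (n + N)))) *\<^sub>R v (n + N))"
    have w1: "snd (w n) = -1" for n using neg[of "n + N"] by (simp add: w_def)
    have w2: "norm (fst (w n)) \<le> L" for n
      using bd[of "n + N"] neg[of "n + N"] by (simp add: w_def field_simps)
    have w3: "w n \<in> frechet_normal_cone (epi ?f) (a (n + N))" for n
      unfolding w_def using neg[of "n + N"] by (intro frechet_normal_cone_scaleR v) auto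
    have w4: "p \<bullet> w n < - \<epsilon>" for n
      using v(2)[of "n + N"] neg[of "n + N"] by (simp add: w_def field_simps)
    have "bounded (range w)"
    proof (rule boundedI)
      fix y assume "y \<in> range w"
      then obtain n where "y = w n" by auto
      moreover have "norm (w n) \<le> norm (fst (w n)) + norm (snd (w n))"
        by (metis norm_Pair_le prod.collapse)
      ultimately show "norm y \<le> L + 1" using w1[of n] w2[of n] by simp
    qed
    then obtain l r where r: "strict_mono (r::nat \<Rightarrow> nat)" "(w \<circ> r) \<longlonglongrightarrow> l"
      using bounded_imp_convergent_subsequence by blast
    have "(\<lambda>n. a (n + N)) \<longlonglongrightarrow> (x, f x)" using alim by (rule LIMSEQ_ignore_initial_segment)
    from LIMSEQ_subseq_LIMSEQ[OF this r(1)]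
    have "l \<in> ?C"
      using r(2) a(1) w3 by (intro clarke_normal_coneI[where a' = "(\<lambda>n. a (n + N)) \<circ> r" and v' = "w \<circ> r"]) auto
    moreover have "p \<bullet> l \<le> - \<epsilon>"
      using tendsto_upperbound[OF tendsto_inner[OF tendsto_const r(2), of p], of "- \<epsilon>"] w4
      by (auto simp: less_imp_le intro!: always_eventually)
    ultimately show False using pos[of l] \<epsilon> by simp
  qed
  then obtain \<delta> where \<delta>: "\<delta> > 0" and near: "\<And>a v. a \<in> epi ?f \<Longrightarrow> a \<in> ball (x, f x) \<delta>
      \<Longrightarrow> v \<in> frechet_normal_cone (epi ?f) a \<Longrightarrow> p \<bullet> v \<ge> \<epsilon> * snd v" by blast
  have "(\<lambda>n. (X n, f (X n))) \<longlonglongrightarrow> (x, f x)"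
    using X isCont_tendsto_compose[OF cont X] by (rule tendsto_Pair)
  then have "\<forall>\<^sub>F n in sequentially. (X n, f (X n)) \<in> ball (x, f x) \<delta>"
    by (rule topological_tendstoD) (use \<delta> in auto)
  then have ev: "\<forall>\<^sub>F n in sequentially. - \<epsilon> \<le> p \<bullet> (Z n, -1)"
  proof (rule eventually_mono)
    fix n assume n: "(X n, f (X n)) \<in> ball (x, f x) \<delta>"
    \<comment> \<open>The estimate \<open>p \<bullet> v \<ge> \<epsilon> * snd v\<close> defines a
      closed half-space, so it extends from Frechet to Clarke normals; vertical component -1 turns
      it into the lower bound \<open>- \<epsilon>\<close>.\<close>
    have "clarke_normal_cone (epi ?f) (X n, f (X n)) \<subseteq> {v. (p - (0, \<epsilon>)) \<bullet> v \<ge> 0}"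
    proof (rule clarke_normal_cone_subset[where U = "ball (x, f x) \<delta>"])
      fix a assume "a \<in> epi ?f \<inter> ball (x, f x) \<delta>"
      then show "frechet_normal_cone (epi ?f) a \<subseteq> {v. (p - (0, \<epsilon>)) \<bullet> v \<ge> 0}"
        using near[of a] by (auto simp: inner_prod_def algebra_simps)
    qed (use n in \<open>auto intro: closed_halfspace_ge convex_halfspace_ge\<close>)
    with mem[of n] have "(p - (0, \<epsilon>)) \<bullet> (Z n, -1) \<ge> 0"
      by (auto simp: clarke_subdiff_def)
    then show "- \<epsilon> \<le> p \<bullet> (Z n, -1)" by (simp add: inner_diff_left)
  qed
  have "(\<lambda>n. p \<bullet> (Z n, -1)) \<longlonglongrightarrow> p \<bullet> (\<zeta>, -1)"
    by (intro tendsto_intros Z)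
  from tendsto_lowerbound[OF this ev] have "- \<epsilon> \<le> p \<bullet> (\<zeta>, -1)" by simp
  with pb(1) \<open>b < 0\<close> show False by (simp add: \<epsilon>_def)
qed

lemma lsc_on_eventually_gt:
  assumes f: "lsc_on S f" and S: "open S" "x \<in> S" and X: "(X \<longlongrightarrow> x) F" and C: "C < f x"
  shows "\<forall>\<^sub>F n in F. C < f (X n)"
proof -
  have "f x \<le> Liminf (at x) f"
    using f S at_within_open[OF S(2,1)] by (auto simp: lsc_on_def)
  with C have "\<forall>\<^sub>F y in at x. C < f y" by (simp add: le_Liminf_iff)
  \<comment> \<open>The limit inferior ignores the point \<open>x\<close> itself;
    \<open>C < f x\<close> covers the indices where \<open>X\<close> equals
    \<open>x\<close>.\<close>
  with C have "\<forall>\<^sub>F y in nhds x. C < f y"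
    by (auto simp: eventually_at_filter elim!: eventually_mono)
  with X show ?thesis by (rule eventually_compose_filterlim[rotated])
qed

text \<open>Along a tangent direction the quadratic error is of second order in the step length
  \<open>t n\<close>. After division by \<open>t n\<close> it vanishes in the limit, so
  \<open>(\<zeta>, -1)\<close> is already a Frechet normal.\<close>

lemma proximal_subgradient_in_clarke_subdiff:
  fixes f :: "'a::real_inner \<Rightarrow> ereal"
  assumes fx: "\<bar>f x\<bar> \<noteq> \<infinity>" and e: "e > 0"
    and prox: "\<And>y. y \<in> ball x e \<Longrightarrow> f x + ereal (\<zeta> \<bullet> (y - x) - c * (norm (y - x))\<^sup>2) \<le> f y"
  shows "\<zeta> \<in> clarke_subdiff f x"
proof -
  obtain r where r: "f x = ereal r" using fx by auto
  have "(\<zeta>, -1) \<in> frechet_normal_cone (epi f) (x, r)"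
    unfolding frechet_normal_cone_def
  proof safe
    fix h \<beta> assume "(h, \<beta>) \<in> tangent_cone (epi f) (x, r)"
    then obtain t w where tw: "\<And>n::nat. t n > 0" "t \<longlonglongrightarrow> 0" "w \<longlonglongrightarrow> (h, \<beta>)"
        "\<And>n. (x, r) + t n *\<^sub>R w n \<in> epi f"
      by (auto simp: tangent_cone_def)
    let ?h = "\<lambda>n. fst (w n)"
    have h: "?h \<longlonglongrightarrow> h" using tendsto_fst[OF tw(3)] by simp
    have b: "(\<lambda>n. snd (w n)) \<longlonglongrightarrow> \<beta>" using tendsto_snd[OF tw(3)] by simp
    have "(\<lambda>n. x + t n *\<^sub>R ?h n) \<longlonglongrightarrow> x + 0 *\<^sub>R h" by (intro tendsto_intros tw h)
    then have "\<forall>\<^sub>F n in sequentially. x + t n *\<^sub>R ?h n \<in> ball x e"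
      using e by (intro topological_tendstoD) auto
    then have ev: "\<forall>\<^sub>F n in sequentially. \<zeta> \<bullet> ?h n - snd (w n) \<le> c * t n * (norm (?h n))\<^sup>2"
    proof (rule eventually_mono)
      fix n assume n: "x + t n *\<^sub>R ?h n \<in> ball x e"
      have "f (x + t n *\<^sub>R ?h n) \<le> ereal (r + t n * snd (w n))"
        using tw(4)[of n] by (auto simp: epi_def case_prod_beta)
      with prox[OF n] have "f x + ereal (\<zeta> \<bullet> (x + t n *\<^sub>R ?h n - x) - c * (norm (x + t n *\<^sub>R ?h n - x))\<^sup>2)
          \<le> ereal (r + t n * snd (w n))"
        by (rule order_trans)
      then have "t n * (\<zeta> \<bullet> ?h n - snd (w n)) \<le> t n * (c * t n * (norm (?h n))\<^sup>2)"
        by (simp add: r algebra_simps power2_eq_square)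
      then show "\<zeta> \<bullet> ?h n - snd (w n) \<le> c * t n * (norm (?h n))\<^sup>2"
        using tw(1)[of n] by simp
    qed
    have "\<zeta> \<bullet> h - \<beta> \<le> c * 0 * (norm h)\<^sup>2"
      by (rule tendsto_le[OF _ _ _ ev]) (intro tendsto_intros tw h b | simp)+
    then show "(\<zeta>, -1) \<bullet> (h, \<beta>) \<le> 0" by simp
  qed
  moreover have "(x, r) \<in> epi f" by (simp add: epi_def r)
  ultimately show ?thesis
    using frechet_subset_clarke_normal_cone by (auto simp: clarke_subdiff_def r)
qed

text \<open>Values come first: the inequality at \<open>X n\<close> tested with \<open>y = x\<close>
  bounds \<open>f (X n)\<close> above by \<open>f x\<close> plus a vanishing term, and lower
  semicontinuity supplies the other half. Only then can the inequality pass to the limit for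
  arbitrary \<open>y\<close>, with quadratic constant \<open>c * (1 + norm \<zeta>)\<close>.\<close>

lemma plr_at_limit:
  fixes f :: "'a::real_inner \<Rightarrow> ereal"
  assumes plr: "plr_at f x" and fx: "\<bar>f x\<bar> \<noteq> \<infinity>"
    and X: "X \<longlonglongrightarrow> x" and Z: "Z \<longlonglongrightarrow> \<zeta>" and mem: "\<And>n::nat. Z n \<in> clarke_subdiff f (X n)"
  shows "(\<lambda>n. f (X n)) \<longlonglongrightarrow> f x" "\<zeta> \<in> clarke_subdiff f x"
proof -
  obtain r where r: "f x = ereal r" using fx by auto
  obtain \<epsilon> c where e: "\<epsilon> > 0" and lsc: "lsc_on (ball x \<epsilon>) f"
    and ineq: "\<And>z \<zeta> y. z \<in> ball x \<epsilon> \<Longrightarrow> \<zeta> \<in> clarke_subdiff f z \<Longrightarrow> y \<in> ball x \<epsilon> \<Longrightarrow>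
         f z + ereal (\<zeta> \<bullet> (y - z) - c * (1 + norm \<zeta>) * (norm (y - z))\<^sup>2) \<le> f y"
    using plr unfolding plr_at_def dom_subdiff_def by blast
  define k where "k = (\<lambda>y n. Z n \<bullet> (y - X n) - c * (1 + norm (Z n)) * (norm (y - X n))\<^sup>2)"
  have k: "k y \<longlonglongrightarrow> \<zeta> \<bullet> (y - x) - c * (1 + norm \<zeta>) * (norm (y - x))\<^sup>2" for y
    unfolding k_def by (intro tendsto_intros X Z)
  have "\<forall>\<^sub>F n in sequentially. X n \<in> ball x \<epsilon>"
    using X e by (intro topological_tendstoD) auto
  then have ev: "\<forall>\<^sub>F n in sequentially. f (X n) + ereal (k y n) \<le> f y" if "y \<in> ball x \<epsilon>" for y
    by (rule eventually_mono) (use ineq that mem in \<open>auto simp: k_def\<close>)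
  show lim: "(\<lambda>n. f (X n)) \<longlonglongrightarrow> f x"
  proof (rule order_tendstoI)
    show "\<forall>\<^sub>F n in sequentially. C < f (X n)" if "C < f x" for C
      using lsc_on_eventually_gt[OF lsc _ _ X that] e by simp
    fix C assume "f x < C"
    have "(\<lambda>n. ereal (r - k x n)) \<longlonglongrightarrow> ereal (r - 0)"
      using k[of x] by (intro tendsto_intros) simp
    then have "\<forall>\<^sub>F n in sequentially. ereal (r - k x n) < C"
      using \<open>f x < C\<close> by (intro order_tendstoD(2)) (auto simp: r)
    moreover have "\<forall>\<^sub>F n in sequentially. f (X n) + ereal (k x n) \<le> f x" using ev e by simp
    ultimately show "\<forall>\<^sub>F n in sequentially. f (X n) < C"
    proof eventually_elim
      case (elim n)
      then have "f (X n) \<le> ereal (r - k x n)" by (cases "f (X n)") (auto simp: r)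
      with elim(1) show ?case by simp
    qed
  qed
  show "\<zeta> \<in> clarke_subdiff f x"
  proof (rule proximal_subgradient_in_clarke_subdiff[where e = \<epsilon> and c = "c * (1 + norm \<zeta>)"])
    fix y assume y: "y \<in> ball x \<epsilon>"
    have "(\<lambda>n. f (X n) + ereal (k y n)) \<longlonglongrightarrow>
        f x + ereal (\<zeta> \<bullet> (y - x) - c * (1 + norm \<zeta>) * (norm (y - x))\<^sup>2)"
      by (intro tendsto_add_ereal lim tendsto_ereal k fx) simp
    then show "f x + ereal (\<zeta> \<bullet> (y - x) - c * (1 + norm \<zeta>) * (norm (y - x))\<^sup>2) \<le> f y"
      by (rule tendsto_upperbound[OF _ ev[OF y]]) simp
  qed (use fx e in auto)
qed

text \<open>Tangents to the graph are limits of rescaled secants, which obey the Lipschitz bound.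
  This is how small velocity forces a small sum of subgradients.\<close>

lemma graphical_derivative_lipschitz_bound:
  fixes F :: "'a::real_normed_vector \<Rightarrow> 'b::real_normed_vector"
  assumes F: "L-lipschitz_on U F" and U: "open U" "x \<in> U" and u: "u \<in> graphical_derivative F x v"
  shows "norm u \<le> L * norm v"
proof -
  obtain t w where tw: "\<And>n::nat. t n > 0" "t \<longlonglongrightarrow> 0" "w \<longlonglongrightarrow> (v, u)"
      "\<And>n. (x, F x) + t n *\<^sub>R w n \<in> {(y, z). z = F y}"
    using u by (auto simp: graphical_derivative_def tangent_cone_def)
  have 1: "(\<lambda>n. fst (w n)) \<longlonglongrightarrow> v" using tendsto_fst[OF tw(3)] by simp
  have 2: "(\<lambda>n. snd (w n)) \<longlonglongrightarrow> u" using tendsto_snd[OF tw(3)] by simp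
  have "(\<lambda>n. x + t n *\<^sub>R fst (w n)) \<longlonglongrightarrow> x + 0 *\<^sub>R v" by (intro tendsto_intros tw 1)
  then have "\<forall>\<^sub>F n in sequentially. x + t n *\<^sub>R fst (w n) \<in> U"
    using U by (intro topological_tendstoD) auto
  then have ev: "\<forall>\<^sub>F n in sequentially. norm (snd (w n)) \<le> L * norm (fst (w n))"
  proof (rule eventually_mono)
    fix n assume n: "x + t n *\<^sub>R fst (w n) \<in> U"
    have "t n *\<^sub>R snd (w n) = F (x + t n *\<^sub>R fst (w n)) - F x"
      using tw(4)[of n] by (simp add: case_prod_beta algebra_simps)
    then have "norm (t n *\<^sub>R snd (w n)) \<le> L * norm (t n *\<^sub>R fst (w n))"
      using lipschitz_onD[OF F n U(2)] by (simp add: dist_norm)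
    then have "t n * norm (snd (w n)) \<le> t n * (L * norm (fst (w n)))"
      using tw(1)[of n] by (simp add: algebra_simps)
    then show "norm (snd (w n)) \<le> L * norm (fst (w n))" using tw(1)[of n] by simp
  qed
  show ?thesis
    by (rule tendsto_le[OF _ _ _ ev]) (intro tendsto_intros 1 2 | simp)+
qed

lemma locally_lipschitz_onE:
  assumes f: "locally_lipschitz_on \<Omega> f" and x: "x \<in> \<Omega>" "open \<Omega>"
  obtains L U where "L-lipschitz_on U f" "open U" "x \<in> U"
proof -
  obtain r L where "r > 0" "L-lipschitz_on (ball x r \<inter> \<Omega>) f"
    using f x unfolding locally_lipschitz_on_def by blast
  then show thesis using x by (intro that[of L "ball x r \<inter> \<Omega>"]) (auto intro: open_Int)
qed

section \<open>Limit sets\<close>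

lemma abs_continuous_imp_continuous_on:
  fixes x :: "real \<Rightarrow> 'a::real_normed_vector"
  assumes "abs_continuous_on_interval a b x"
  shows "continuous_on {a..b} x"
  unfolding continuous_on_iff
proof (intro ballI allI impI)
  fix s e :: real assume s: "s \<in> {a..b}" and "e > 0"
  with assms obtain \<delta> where \<delta>: "\<delta> > 0" "\<And>D. finite D \<and> (\<forall>(s, t)\<in>D. a \<le> s \<and> s < t \<and> t \<le> b) \<and>
      pairwise (\<lambda>p q. disjnt {fst p<..<snd p} {fst q<..<snd q}) D \<and>
      (\<Sum>(s, t)\<in>D. t - s) < \<delta> \<Longrightarrow> (\<Sum>(s, t)\<in>D. norm (x t - x s)) < e"
    unfolding abs_continuous_on_interval_def by blast
  have lt: "dist (x v) (x u) < e" if "a \<le> u" "u < v" "v \<le> b" "v - u < \<delta>" for u v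
    using \<delta>(2)[of "{(u, v)}"] that by (simp add: dist_norm)
  have "dist (x t) (x s) < e" if "t \<in> {a..b}" "dist t s < \<delta>" for t
    using lt[of s t] lt[of t s] that s \<open>e > 0\<close>
    by (cases s t rule: linorder_cases) (auto simp: dist_commute dist_real_def)
  with \<delta>(1) show "\<exists>d>0. \<forall>x'\<in>{a..b}. dist x' s < d \<longrightarrow> dist (x x') (x s) < e" by blast
qed

text \<open>Tails indexed by integers form a decreasing sequence, so the nested intersection
  theorems for compact and connected sets become applicable.\<close>

lemma omega_limit_set_eq_Inter:
  fixes x :: "real \<Rightarrow> 'a::metric_space"
  shows "omega_limit_set x = (\<Inter>n::nat. closure (x ` {real n..}))"
proof (intro equalityI subsetI)
  fix z assume "z \<in> omega_limit_set x"
  then obtain t where t: "filterlim t at_top sequentially" "(\<lambda>n. x (t n)) \<longlonglongrightarrow> z"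
    by (auto simp: omega_limit_set_def)
  show "z \<in> (\<Inter>n::nat. closure (x ` {real n..}))"
  proof
    fix m :: nat
    have "\<forall>\<^sub>F n in sequentially. real m \<le> t n"
      using t(1) by (auto simp: filterlim_at_top)
    then have "\<forall>\<^sub>F n in sequentially. x (t n) \<in> closure (x ` {real m..})"
      by (rule eventually_mono) (auto intro!: subsetD[OF closure_subset])
    then show "z \<in> closure (x ` {real m..})"
      using Lim_in_closed_set[OF closed_closure _ _ t(2)] by simp
  qed
next
  fix z assume z: "z \<in> (\<Inter>n::nat. closure (x ` {real n..}))"
  have "\<exists>t. real n \<le> t \<and> dist (x t) z < inverse (real (Suc n))" for n
  proof -
    have "z \<in> closure (x ` {real n..})" using z by blast
    then have "\<exists>y\<in>x ` {real n..}. dist y z < inverse (real (Suc n))"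
      unfolding closure_approachable by simp
    then show ?thesis by auto
  qed
  then have "\<forall>n. \<exists>t. real n \<le> t \<and> dist (x t) z < inverse (real (Suc n))" by blast
  from choice[OF this] obtain t where t: "\<And>n. real n \<le> t n" "\<And>n. dist (x (t n)) z < inverse (real (Suc n))"
    by blast
  have "filterlim t at_top sequentially"
    by (rule filterlim_at_top_mono[OF filterlim_real_sequentially]) (use t in auto)
  moreover have "(\<lambda>n. x (t n)) \<longlonglongrightarrow> z"
  proof (rule metric_tendsto_imp_tendsto[OF LIMSEQ_inverse_real_of_nat])
    show "\<forall>\<^sub>F n in sequentially. dist (x (t n)) z \<le> dist (inverse (real (Suc n))) 0"
      using t(2) by (auto simp: less_imp_le intro!: always_eventually)
  qed
  moreover have "0 \<le> t n" for n using t(1)[of n] by linarith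
  ultimately show "z \<in> omega_limit_set x" by (auto simp: omega_limit_set_def)
qed

lemma omega_limit_set_bounded:
  fixes x :: "real \<Rightarrow> 'a::euclidean_space"
  assumes bdd: "bounded (x ` {0..})" and cont: "continuous_on {0..} x"
  shows "omega_limit_set x \<noteq> {}" "compact (omega_limit_set x)" "connected (omega_limit_set x)"
proof -
  define K where "K = (\<lambda>n::nat. closure (x ` {real n..}))"
  have eq: "omega_limit_set x = \<Inter>(range K)"
    unfolding omega_limit_set_eq_Inter K_def ..
  have comp: "compact (K n)" for n
    unfolding K_def compact_closure
    by (rule bounded_subset[OF bdd]) auto
  have conn: "connected (K n)" for n
    unfolding K_def
    by (intro connected_imp_connected_closure connected_continuous_image continuous_on_subset[OF cont]) auto
  have mono: "K n \<subseteq> K m" if "m \<le> n" for m n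
    unfolding K_def using that by (intro closure_mono image_mono) auto
  show "omega_limit_set x \<noteq> {}"
    unfolding eq by (rule compact_nest[OF comp _ mono]) (auto simp: K_def)
  show "compact (omega_limit_set x)"
    unfolding eq by (rule compact_Inter) (use comp in auto)
  show "connected (omega_limit_set x)"
    unfolding eq by (rule connected_nest[OF comp conn mono])
qed

text \<open>Otherwise the curve crosses a small sphere around \<open>z\<close> at arbitrarily late times, which
  produces a second limit point close to \<open>z\<close>.\<close>

lemma isolated_in_omega_limit_set_tendsto:
  fixes x :: "real \<Rightarrow> 'a::heine_borel"
  assumes cont: "continuous_on {0..} x" and iso: "z isolated_in omega_limit_set x"
  shows "(x \<longlongrightarrow> z) at_top"
proof (rule ccontr)
  assume "\<not> (x \<longlongrightarrow> z) at_top"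
  then obtain e0 where e0: "e0 > 0" "\<not> (\<forall>\<^sub>F t in at_top. dist (x t) z < e0)"
    by (auto simp: tendsto_iff)
  obtain e1 where z: "z \<in> omega_limit_set x" and e1: "e1 > 0" "\<And>y. y \<in> omega_limit_set x \<Longrightarrow> dist z y < e1 \<Longrightarrow> y = z"
    using iso by (auto simp: isolated_in_dist_Ex_iff)
  \<comment> \<open>\<open>e \<le> e0\<close> ensures that the curve leaves the ball of radius
    \<open>e\<close> again and again; \<open>e < e1\<close> makes a limit point at distance
    \<open>e\<close> contradict isolation.\<close>
  define e where "e = min e0 (e1 / 2)"
  have e: "e > 0" "e \<le> e0" "e < e1" using e0 e1 by (auto simp: e_def)
  obtain t where t: "filterlim t at_top sequentially" "(\<lambda>n. x (t n)) \<longlonglongrightarrow> z"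
    using z by (auto simp: omega_limit_set_def)
  have "\<exists>s. real n \<le> s \<and> dist (x s) z = e" for n :: nat
  proof -
    have "\<forall>\<^sub>F k in sequentially. real n \<le> t k \<and> dist (x (t k)) z < e"
      using t e(1) by (auto simp: filterlim_at_top tendsto_iff intro: eventually_conj)
    then obtain a where a: "real n \<le> a" "dist (x a) z < e"
      by (auto simp: eventually_sequentially)
    have "\<exists>b\<ge>a. \<not> dist (x b) z < e0"
      using e0(2) by (auto simp: eventually_at_top_linorder)
    then obtain b where b: "a \<le> b" "e \<le> dist (x b) z" using e by auto
    have "continuous_on {a..b} (\<lambda>s. dist (x s) z)"
      using a by (intro continuous_intros continuous_on_subset[OF cont]) auto
    then obtain s where "a \<le> s" "s \<le> b" "dist (x s) z = e"
      using IVT'[of "\<lambda>s. dist (x s) z" a e b] a b by auto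
    with a show ?thesis by (intro exI[of _ s]) auto
  qed
  then have "\<forall>n. \<exists>s. real n \<le> s \<and> dist (x s) z = e" by blast
  from choice[OF this] obtain s where s: "\<And>n. real n \<le> s n" "\<And>n. dist (x (s n)) z = e" by blast
  have "bounded (range (\<lambda>n. x (s n)))"
    using s(2) by (auto simp: bounded_def dist_commute intro!: exI[of _ z] exI[of _ e])
  then obtain y r where r: "strict_mono (r::nat \<Rightarrow> nat)" "((\<lambda>n. x (s n)) \<circ> r) \<longlonglongrightarrow> y"
    using bounded_imp_convergent_subsequence by blast
  have "filterlim s at_top sequentially"
    by (rule filterlim_at_top_mono[OF filterlim_real_sequentially]) (use s in auto)
  then have "filterlim (\<lambda>n. s (r n)) at_top sequentially"
    using filterlim_compose filterlim_subseq[OF r(1)] by blast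
  moreover have "0 \<le> s (r n)" for n using s(1)[of "r n"] by linarith
  ultimately have y: "y \<in> omega_limit_set x"
    using r(2) unfolding omega_limit_set_def mem_Collect_eq
    by (intro exI[of _ "\<lambda>n. s (r n)"]) (auto simp: o_def)
  have "(\<lambda>n. dist (x (s (r n))) z) \<longlonglongrightarrow> dist y z"
    using r(2) by (intro tendsto_intros) (simp add: o_def)
  then have "dist y z = e" using s(2) LIMSEQ_unique[OF _ tendsto_const] by simp
  with e1(2)[OF y] e show False by (simp add: dist_commute)
qed

section \<open>Energy dissipation\<close>

lemma AE_lebesgue_on_subset:
  assumes "AE t in lebesgue_on S. P t" "T \<subseteq> S" "S \<in> sets lebesgue" "T \<in> sets lebesgue"
  shows "AE t in lebesgue_on T. P t"
  using assms by (auto simp: AE_restrict_space_iff elim!: eventually_mono)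

text \<open>Chebyshev's argument on a set of measure 1. The factor 2 leaves a strict gap between
  \<open>(2 * \<kappa>)\<^sup>2\<close> and \<open>\<kappa>\<^sup>2\<close>, and excluding a null
  set keeps \<open>P\<close> available at the chosen time.\<close>

lemma exists_small_of_nn_integral_le:
  fixes g :: "real \<Rightarrow> 'a::real_normed_vector"
  assumes P: "AE t in lebesgue_on {a..a + 1}. P t" and \<kappa>: "\<kappa> > 0"
    and en: "(\<integral>\<^sup>+t. ennreal ((norm (g t))\<^sup>2) \<partial>lebesgue_on {a..a + 1}) \<le> ennreal (\<kappa>\<^sup>2)"
  shows "\<exists>t\<in>{a..a + 1}. P t \<and> norm (g t) \<le> 2 * \<kappa>"
proof (rule ccontr)
  let ?M = "lebesgue_on {a..a + 1}"
  assume neg: "\<not> ?thesis"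
  have "AE t in ?M. ennreal ((2 * \<kappa>)\<^sup>2) \<le> ennreal ((norm (g t))\<^sup>2)"
    using P AE_space
  proof eventually_elim
    case (elim t)
    with neg have "2 * \<kappa> < norm (g t)" by auto
    then show ?case using \<kappa> by (intro ennreal_leI power_mono) auto
  qed
  from nn_integral_mono_AE[OF this] have "ennreal ((2 * \<kappa>)\<^sup>2) \<le> (\<integral>\<^sup>+t. ennreal ((norm (g t))\<^sup>2) \<partial>?M)"
    by (simp add: emeasure_restrict_space)
  also note en
  finally have "(2 * \<kappa>)\<^sup>2 \<le> \<kappa>\<^sup>2" by (simp add: ennreal_le_iff)
  with \<kappa> show False by (simp add: power_mult_distrib)
qed

lemma vector_derivative_within_Ici:
  fixes x :: "real \<Rightarrow> 'a::real_normed_vector"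
  assumes "(x has_vector_derivative d) (at t within {0..})" "0 \<le> t"
  shows "vector_derivative x (at t within {0..}) = d"
proof (rule vector_derivative_within[OF _ assms(1)])
  have "at_right t \<le> at t within {0..}"
    using assms(2) by (intro at_le) auto
  then show "at t within {0..} \<noteq> bot"
    using trivial_limit_at_right_real[of t] by (metis bot.extremum_uniqueI)
qed

text \<open>Over unit time windows the velocity has small \<open>L\<^sup>2\<close> norm, so the curve hardly moves there;
  a good time may thus be selected in the window starting at any time close to the limit point.\<close>

lemma slow_times:
  fixes x :: "real \<Rightarrow> 'a::euclidean_space"
  assumes ac: "\<And>a b. 0 \<le> a \<Longrightarrow> a \<le> b \<Longrightarrow> abs_continuous_on_interval a b x"
    and P: "AE t in lebesgue_on {0..}. \<exists>d. (x has_vector_derivative d) (at t within {0..}) \<and> P t d"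
    and en: "\<And>\<epsilon>. \<epsilon> > 0 \<Longrightarrow> \<forall>\<^sub>F t in at_top. (\<integral>\<^sup>+\<tau>. ennreal ((norm (vector_derivative x (at \<tau> within {0..})))\<^sup>2)
          \<partial>lebesgue_on {t..t + 1}) \<le> ennreal \<epsilon>"
    and z: "z \<in> omega_limit_set x"
  obtains s :: "nat \<Rightarrow> real" and d where "\<And>n. 0 \<le> s n" "filterlim s at_top sequentially" "(\<lambda>n. x (s n)) \<longlonglongrightarrow> z"
    "\<And>n. (x has_vector_derivative d n) (at (s n) within {0..})" "\<And>n. P (s n) (d n)" "d \<longlonglongrightarrow> 0"
proof -
  let ?g = "\<lambda>\<tau>. vector_derivative x (at \<tau> within {0..})"
  obtain t where t: "filterlim t at_top sequentially" "(\<lambda>n. x (t n)) \<longlonglongrightarrow> z"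
    using z by (auto simp: omega_limit_set_def)
  have step: "\<exists>s d. real n \<le> s \<and> dist (x s) z \<le> 2 * \<kappa> \<and> (x has_vector_derivative d) (at s within {0..}) \<and>
      P s d \<and> norm d \<le> 2 * \<kappa>" if \<kappa>: "\<kappa> > 0" for n \<kappa>
  proof -
    let ?E = "\<lambda>a b. \<integral>\<^sup>+\<tau>. ennreal ((norm (?g \<tau>))\<^sup>2) \<partial>lebesgue_on {a..b}"
    have "\<forall>\<^sub>F a in at_top. ?E a (a + 1) \<le> ennreal (\<kappa>\<^sup>2)" using en \<kappa> by simp
    then have "\<forall>\<^sub>F k in sequentially. ?E (t k) (t k + 1) \<le> ennreal (\<kappa>\<^sup>2)"
      using t(1) by (rule eventually_compose_filterlim)
    moreover have "\<forall>\<^sub>F k in sequentially. real n \<le> t k" using t(1) by (simp add: filterlim_at_top)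
    moreover have "\<forall>\<^sub>F k in sequentially. dist (x (t k)) z < \<kappa>" using t(2) \<kappa> by (simp add: tendsto_iff)
    ultimately have "\<forall>\<^sub>F k in sequentially. ?E (t k) (t k + 1) \<le> ennreal (\<kappa>\<^sup>2) \<and> real n \<le> t k \<and> dist (x (t k)) z < \<kappa>"
      by eventually_elim auto
    then obtain k where k: "?E (t k) (t k + 1) \<le> ennreal (\<kappa>\<^sup>2)" "real n \<le> t k" "dist (x (t k)) z < \<kappa>"
      using eventually_happens'[OF sequentially_bot] by blast
    define a where "a = t k"
    have a: "0 \<le> a" "?E a (a + 1) \<le> ennreal (\<kappa>\<^sup>2)" using k by (auto simp: a_def)
    have der: "AE t in lebesgue_on {0..}. (x has_vector_derivative ?g t) (at t within {0..}) \<and> P t (?g t)"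
      using P AE_space
    proof eventually_elim
      case (elim t)
      then obtain d where d: "(x has_vector_derivative d) (at t within {0..})" "P t d" by blast
      have "?g t = d" using vector_derivative_within_Ici[OF d(1)] elim by simp
      with d show ?case by simp
    qed
    obtain s where s: "a \<le> s" "s \<le> a + 1" "(x has_vector_derivative ?g s) (at s within {0..})"
        "P s (?g s)" "norm (?g s) \<le> 2 * \<kappa>"
      using exists_small_of_nn_integral_le[OF AE_lebesgue_on_subset[OF der] \<kappa> a(2)] a(1) by auto
    \<comment> \<open>Moving from \<open>a\<close> to the good time \<open>s\<close> costs at most
      \<kappa>, and \<open>x a\<close> was within \<kappa> of \<open>z\<close>; hence the constant
      2.\<close>
    have "norm (x s - x a) \<le> \<kappa>"
    proof (rule abs_continuous_increment_le[OF s(1,2) ac[OF a(1) s(1)] _ \<kappa>])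
      have "AE t in lebesgue_on {a..s}. (x has_vector_derivative ?g t) (at t within {0..}) \<and> P t (?g t)"
        by (rule AE_lebesgue_on_subset[OF der]) (use a in auto)
      then show "AE t in lebesgue_on {a..s}. (x has_vector_derivative ?g t) (at t within {a..s})"
        by (rule eventually_mono) (use a in \<open>auto elim: has_vector_derivative_within_subset\<close>)
      have "?E a s \<le> ?E a (a + 1)"
        using s by (auto simp: nn_integral_restrict_space intro!: nn_integral_mono split: split_indicator)
      with a(2) show "?E a s \<le> ennreal (\<kappa>\<^sup>2)" by simp
    qed
    then have "dist (x s) z \<le> 2 * \<kappa>"
      using k(3) dist_triangle[of "x s" z "x a"] by (simp add: a_def dist_norm)
    with s k(2) show ?thesis
      by (intro exI[of _ s] exI[of _ "?g s"]) (auto simp: a_def)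
  qed
  have "\<forall>n. \<exists>q. real n \<le> fst q \<and> dist (x (fst q)) z \<le> 2 * inverse (real (Suc n)) \<and>
      (x has_vector_derivative snd q) (at (fst q) within {0..}) \<and>
      P (fst q) (snd q) \<and> norm (snd q) \<le> 2 * inverse (real (Suc n))"
    using step[of "inverse (real (Suc _))"] by simp
  from choice[OF this] obtain q where q: "\<And>n. real n \<le> fst (q n)" "\<And>n. dist (x (fst (q n))) z \<le> 2 * inverse (real (Suc n))"
      "\<And>n. (x has_vector_derivative snd (q n)) (at (fst (q n)) within {0..})"
      "\<And>n. P (fst (q n)) (snd (q n))" "\<And>n. norm (snd (q n)) \<le> 2 * inverse (real (Suc n))"
    by blast
  have inv: "(\<lambda>n. 2 * inverse (real (Suc n))) \<longlonglongrightarrow> 0"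
    using tendsto_mult_left[OF LIMSEQ_inverse_real_of_nat, of 2] by simp
  show thesis
  proof (rule that[of "\<lambda>n. fst (q n)" "\<lambda>n. snd (q n)"])
    show "0 \<le> fst (q n)" for n using q(1)[of n] by linarith
    show "filterlim (\<lambda>n. fst (q n)) at_top sequentially"
      by (rule filterlim_at_top_mono[OF filterlim_real_sequentially]) (use q in auto)
    show "(\<lambda>n. x (fst (q n))) \<longlonglongrightarrow> z"
      by (rule metric_tendsto_imp_tendsto[OF inv]) (use q(2) in \<open>auto intro!: always_eventually\<close>)
    show "(\<lambda>n. snd (q n)) \<longlonglongrightarrow> 0"
      by (rule metric_tendsto_imp_tendsto[OF inv]) (use q(5) in \<open>auto intro!: always_eventually\<close>)
  qed (use q in auto)
qed

text \<open>The dissipation is nonnegative, so \<open>h 0 - h t\<close> is too. An infinite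
  \<open>h t\<close> would make that difference \<open>-\<infinity>\<close>, which yields finiteness
  before any subtraction is trusted.\<close>

lemma energy_antimono:
  fixes h :: "real \<Rightarrow> ereal" and E :: "real \<Rightarrow> real \<Rightarrow> ennreal"
  assumes fin: "h 0 < \<infinity>" and mInf: "\<And>t. h t \<noteq> -\<infinity>" and \<rho>: "\<rho> > 0"
    and en: "\<And>s t. 0 \<le> s \<Longrightarrow> s < t \<Longrightarrow> ereal \<rho> * enn2ereal (E s t) \<le> h s - h t"
  shows "0 \<le> t \<Longrightarrow> \<bar>h t\<bar> \<noteq> \<infinity>" "0 \<le> s \<Longrightarrow> s \<le> t \<Longrightarrow> h t \<le> h s"
proof -
  have diff: "0 \<le> h s - h t" if "0 \<le> s" "s < t" for s t
    using en[OF that] \<rho> by (meson enn2ereal_nonneg ereal_0_le_mult ereal_less(2) less_imp_le order_trans)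
  have "h t < \<infinity>" if "0 \<le> t" for t
    using diff[of 0 t] fin mInf[of 0] that by (cases "t = 0"; cases "h 0"; cases "h t") auto
  with mInf show *: "0 \<le> t \<Longrightarrow> \<bar>h t\<bar> \<noteq> \<infinity>" for t by force
  show "h t \<le> h s" if "0 \<le> s" "s \<le> t"
    using diff[of s t] *[of s] *[of t] that by (cases "s = t"; cases "h s"; cases "h t") auto
qed

text \<open>A decreasing function bounded below is eventually within
  \<open>\<rho> * \<epsilon>\<close> of its infimum. From then on every drop over a window is
  smaller than that, and division by \<rho> bounds the dissipation.\<close>

lemma energy_window_small:
  fixes h :: "real \<Rightarrow> ereal" and E :: "real \<Rightarrow> real \<Rightarrow> ennreal"
  assumes fin: "h 0 < \<infinity>" and lower: "\<And>t. 0 \<le> t \<Longrightarrow> ereal m \<le> h t" and mInf: "\<And>t. h t \<noteq> -\<infinity>" and \<rho>: "\<rho> > 0"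
    and en: "\<And>s t. 0 \<le> s \<Longrightarrow> s < t \<Longrightarrow> ereal \<rho> * enn2ereal (E s t) \<le> h s - h t"
    and \<epsilon>: "\<epsilon> > 0"
  shows "\<forall>\<^sub>F t in at_top. E t (t + 1) \<le> ennreal \<epsilon>"
proof -
  have fin_h: "\<bar>h t\<bar> \<noteq> \<infinity>" if "0 \<le> t" for t
    by (rule energy_antimono(1)[where h = h and E = E, OF fin mInf \<rho>]) (use en that in auto)
  have anti: "h t \<le> h s" if "0 \<le> s" "s \<le> t" for s t
    by (rule energy_antimono(2)[where h = h and E = E, OF fin mInf \<rho>]) (use en that in auto)
  define H where "H = (\<lambda>t. real_of_ereal (h t))"
  have H: "h t = ereal (H t)" if "0 \<le> t" for t
    using fin_h[OF that] by (simp add: H_def ereal_real)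
  have Hm: "m \<le> H t" if "0 \<le> t" for t using lower[OF that] H[OF that] by simp
  have Ha: "H t \<le> H s" if "0 \<le> s" "s \<le> t" for s t using anti[OF that] H[of s] H[of t] that by simp
  let ?l = "INF t\<in>{0..}. H t"
  have bdd: "bdd_below (H ` {0..})" using Hm by (intro bdd_belowI[of _ m]) auto
  have "?l < ?l + \<rho> * \<epsilon>" using \<rho> \<epsilon> by simp
  then obtain T where T: "0 \<le> T" "H T < ?l + \<rho> * \<epsilon>"
    by (subst (asm) cINF_less_iff[OF _ bdd]) auto
  have "E t (t + 1) \<le> ennreal \<epsilon>" if "T \<le> t" for t
  proof -
    have "H t < H (t + 1) + \<rho> * \<epsilon>"
      using Ha[OF T(1) that] T cINF_lower[OF bdd, of "t + 1"] that by auto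
    then have "ereal \<rho> * enn2ereal (E t (t + 1)) \<le> ereal (\<rho> * \<epsilon>)"
      using en[of t "t + 1"] H[of t] H[of "t + 1"] T(1) that by (auto intro: order_trans)
    then have "enn2ereal (E t (t + 1)) \<le> ereal \<epsilon>"
      using \<rho> enn2ereal_nonneg[of "E t (t + 1)"] by (cases "enn2ereal (E t (t + 1))") auto
    then have "enn2ereal (E t (t + 1)) \<le> enn2ereal (ennreal \<epsilon>)" using \<epsilon> by simp
    then show ?thesis by (simp add: less_eq_ennreal.rep_eq)
  qed
  then show ?thesis using eventually_ge_at_top[of T] by (rule eventually_mono[rotated])
qed

section \<open>Passage to the limit along the curve\<close>

lemma lsc_add_limit_le:
  fixes f :: "'a::metric_space \<Rightarrow> ereal" and g :: "'a \<Rightarrow> real"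
  assumes f: "lsc_on UNIV f" and g: "lsc_on UNIV (\<lambda>y. ereal (g y))" and y: "(y \<longlongrightarrow> z) F"
    and ev: "\<forall>\<^sub>F n in F. f (y n) + ereal (g (y n)) \<le> ereal r" and F: "F \<noteq> bot"
  shows "f z + ereal (g z) \<le> ereal r"
proof (rule ccontr)
  assume "\<not> ?thesis"
  then have "ereal (r - g z) < f z" by (cases "f z") auto
  \<comment> \<open>The number \<open>q\<close> splits the budget \<open>r\<close>: eventually
    \<open>f (y n) > q\<close> and \<open>g (y n) > r - q\<close>, so the sum exceeds
    \<open>r\<close>. Sums of extended-real lower limits are thus avoided.\<close>
  then obtain q where q: "ereal (r - g z) < ereal q" "ereal q < f z" using ereal_dense2 by blast
  have "\<forall>\<^sub>F n in F. ereal q < f (y n)"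
    by (rule lsc_on_eventually_gt[OF f _ _ y q(2)]) auto
  moreover have "\<forall>\<^sub>F n in F. ereal (r - q) < ereal (g (y n))"
    by (rule lsc_on_eventually_gt[OF g _ _ y]) (use q in auto)
  ultimately have "\<forall>\<^sub>F n in F. False"
    using ev
  proof eventually_elim
    case (elim n)
    then show False by (cases "f (y n)") auto
  qed
  with F show False by simp
qed

lemma ext_infdist_zero_tendsto_zero:
  assumes "\<And>n. u n \<in> S n" "u \<longlonglongrightarrow> (0::'a::real_normed_vector)"
  shows "(\<lambda>n::nat. ext_infdist 0 (S n)) \<longlonglongrightarrow> 0"
proof (rule tendsto_sandwich[where f = "\<lambda>_. 0" and h = "\<lambda>n. ereal (norm (u n))"])
  show "\<forall>\<^sub>F n in sequentially. 0 \<le> ext_infdist 0 (S n)"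
    by (auto simp: ext_infdist_def intro!: always_eventually INF_greatest)
  show "\<forall>\<^sub>F n in sequentially. ext_infdist 0 (S n) \<le> ereal (norm (u n))"
    using assms(1) by (auto simp: ext_infdist_def intro!: always_eventually INF_lower2)
  show "(\<lambda>n. ereal (norm (u n))) \<longlonglongrightarrow> 0"
    using tendsto_norm_zero[OF assms(2)] tendsto_ereal by (force simp: zero_ereal_def)
qed simp

lemma energetic_omega_limit:
  fixes \<phi>1 :: "'a::euclidean_space \<Rightarrow> ereal" and \<phi>2 :: "'a \<Rightarrow> real"
  assumes mInf: "\<And>y. \<phi>1 y \<noteq> -\<infinity>"
    and lsc1: "lsc_on UNIV \<phi>1" and lsc2: "lsc_on UNIV (\<lambda>y. ereal (\<phi>2 y))"
    and x0: "\<phi>1 x0 < \<infinity>" and \<Omega>: "open \<Omega>"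
    and sub: "{y. \<phi>1 y + ereal (\<phi>2 y) \<le> \<phi>1 x0 + ereal (\<phi>2 x0)} \<subseteq> \<Omega>"
    and plr: "plr_on \<Omega> \<phi>1" and lip2: "locally_lipschitz_on \<Omega> \<phi>2" and lipF: "locally_lipschitz_on \<Omega> F"
    and sol: "is_energetic_solution \<phi>1 \<phi>2 F x0 x" and z: "z \<in> omega_limit_set x"
  shows "z \<in> stationary_set \<phi>1 \<phi>2"
    and "\<exists>(s :: nat \<Rightarrow> real) xdot. (\<forall>n. 0 \<le> s n) \<and> filterlim s at_top sequentially \<and>
      (\<lambda>n. x (s n)) \<longlonglongrightarrow> z \<and>
      (\<forall>n. (x has_vector_derivative xdot n) (at (s n) within {0..})) \<and> xdot \<longlonglongrightarrow> 0 \<and>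
      (\<lambda>n. \<phi>1 (x (s n)) + ereal (\<phi>2 (x (s n)))) \<longlonglongrightarrow> \<phi>1 z + ereal (\<phi>2 z) \<and>
      (\<lambda>n. ext_infdist 0 (clarke_subdiff \<phi>1 (x (s n))
             + clarke_subdiff (\<lambda>y. ereal (\<phi>2 y)) (x (s n)))) \<longlonglongrightarrow> 0"
proof -
  let ?f2 = "\<lambda>y. ereal (\<phi>2 y)"
  let ?E = "\<lambda>s t. \<integral>\<^sup>+\<tau>. ennreal ((norm (vector_derivative x (at \<tau> within {0..})))\<^sup>2) \<partial>lebesgue_on {s..t}"
  define h where "h = (\<lambda>t. \<phi>1 (x t) + ereal (\<phi>2 (x t)))"
  have x_0: "x 0 = x0" and ac: "\<And>a b. 0 \<le> a \<Longrightarrow> a \<le> b \<Longrightarrow> abs_continuous_on_interval a b x"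
    using sol by (auto simp: is_energetic_solution_def is_solution_def)
  obtain v w where vw: "AE t in lebesgue_on {0..}.
      v t \<in> clarke_subdiff \<phi>1 (x t) \<and> w t \<in> clarke_subdiff ?f2 (x t) \<and>
      (\<exists>xdot. (x has_vector_derivative xdot) (at t within {0..}) \<and>
        v t + w t \<in> uminus ` graphical_derivative F (x t) xdot)"
    using sol by (auto simp: is_energetic_solution_def is_solution_def)
  obtain \<rho> where \<rho>: "\<rho> > 0" and en: "\<And>s t. 0 \<le> s \<Longrightarrow> s < t \<Longrightarrow> ereal \<rho> * enn2ereal (?E s t) \<le> h s - h t"
    using sol unfolding is_energetic_solution_def h_def by blast
  have h0: "h 0 < \<infinity>" and hm: "h t \<noteq> -\<infinity>" for t
    using x0 mInf[of "x t"] by (auto simp: h_def x_0)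
  have hfin: "\<bar>h t\<bar> \<noteq> \<infinity>" if "0 \<le> t" for t
    by (rule energy_antimono(1)[where h = h and E = ?E, OF h0 hm \<rho>]) (use en that in auto)
  have hanti: "h t \<le> h s" if "0 \<le> s" "s \<le> t" for s t
    by (rule energy_antimono(2)[where h = h and E = ?E, OF h0 hm \<rho>]) (use en that in auto)
  have below: "\<phi>1 z + ereal (\<phi>2 z) \<le> h t" if t: "0 \<le> t" for t
  proof -
    obtain \<tau> where \<tau>: "filterlim \<tau> at_top sequentially" "(\<lambda>n. x (\<tau> n)) \<longlonglongrightarrow> z"
      using z by (auto simp: omega_limit_set_def)
    have "\<forall>\<^sub>F n in sequentially. t \<le> \<tau> n" using \<tau>(1) by (simp add: filterlim_at_top)
    then have "\<forall>\<^sub>F n in sequentially. h (\<tau> n) \<le> h t"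
      by (rule eventually_mono) (use hanti t in auto)
    moreover obtain r where "h t = ereal r" using hfin[OF t] by auto
    ultimately show ?thesis
      using lsc_add_limit_le[OF lsc1 lsc2 \<tau>(2), of r] by (simp add: h_def)
  qed
  have zfin: "\<bar>\<phi>1 z\<bar> \<noteq> \<infinity>"
    using below[of 0] h0 mInf[of z] by (cases "\<phi>1 z"; cases "h 0") auto
  then obtain m where m: "\<phi>1 z + ereal (\<phi>2 z) = ereal m" by (cases "\<phi>1 z") auto
  have z\<Omega>: "z \<in> \<Omega>" using sub below[of 0] by (auto simp: h_def x_0)
  have small: "\<forall>\<^sub>F t in at_top. ?E t (t + 1) \<le> ennreal \<epsilon>" if "\<epsilon> > 0" for \<epsilon>
    by (rule energy_window_small[where h = h and E = ?E and m = m, OF h0 _ hm \<rho> en that])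
      (use below m in auto)
  define P where "P = (\<lambda>t d. v t \<in> clarke_subdiff \<phi>1 (x t) \<and> w t \<in> clarke_subdiff ?f2 (x t) \<and>
      v t + w t \<in> uminus ` graphical_derivative F (x t) d)"
  have AEP: "AE t in lebesgue_on {0..}. \<exists>d. (x has_vector_derivative d) (at t within {0..}) \<and> P t d"
    using vw by (rule eventually_mono) (auto simp: P_def)
  obtain s d where s: "\<And>n::nat. 0 \<le> s n" "filterlim s at_top sequentially" "(\<lambda>n. x (s n)) \<longlonglongrightarrow> z"
    and d: "\<And>n. (x has_vector_derivative d n) (at (s n) within {0..})" "\<And>n. P (s n) (d n)" "d \<longlonglongrightarrow> 0"
    using slow_times[OF ac AEP small z] by blast
  obtain L U where U: "L-lipschitz_on U \<phi>2" "open U" "z \<in> U"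
    by (rule locally_lipschitz_onE[OF lip2 z\<Omega> \<Omega>])
  obtain L' U' where U': "L'-lipschitz_on U' F" "open U'" "z \<in> U'"
    by (rule locally_lipschitz_onE[OF lipF z\<Omega> \<Omega>])
  have "\<forall>\<^sub>F n in sequentially. x (s n) \<in> U \<inter> U'"
    by (rule topological_tendstoD[OF s(3)]) (use U U' in auto)
  then obtain N where N: "\<And>n. N \<le> n \<Longrightarrow> x (s n) \<in> U \<inter> U'" by (auto simp: eventually_sequentially)
  have "bounded (range (\<lambda>n. w (s (n + N))))"
  proof (rule boundedI)
    fix y assume "y \<in> range (\<lambda>n. w (s (n + N)))"
    then obtain n where y: "y = w (s (n + N))" by auto
    show "norm y \<le> L"
      using clarke_subdiff_lipschitz_bound[OF U(1,2), of "x (s (n + N))" y] N[of "n + N"] d(2)[of "n + N"]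
      by (simp add: P_def y)
  qed
  then obtain \<zeta> r where r: "strict_mono r" "((\<lambda>n. w (s (n + N))) \<circ> r) \<longlonglongrightarrow> \<zeta>"
    using bounded_imp_convergent_subsequence by blast
  define k where "k = (\<lambda>n. r n + N)"
  have k: "strict_mono k" using r(1) by (simp add: k_def strict_mono_def)
  have kU: "x (s (k n)) \<in> U" "x (s (k n)) \<in> U'" for n using N[of "k n"] by (auto simp: k_def)
  have wlim: "(\<lambda>n. w (s (k n))) \<longlonglongrightarrow> \<zeta>" using r(2) by (simp add: k_def o_def)
  have slim: "filterlim (\<lambda>n. s (k n)) at_top sequentially"
    using filterlim_compose[OF s(2) filterlim_subseq[OF k]] .
  have xlim: "(\<lambda>n. x (s (k n))) \<longlonglongrightarrow> z"
    using LIMSEQ_subseq_LIMSEQ[OF s(3) k] by (simp add: o_def)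
  have dlim: "(\<lambda>n. d (k n)) \<longlonglongrightarrow> 0"
    using LIMSEQ_subseq_LIMSEQ[OF d(3) k] by (simp add: o_def)
  have "norm (v (s (k n)) + w (s (k n))) \<le> L' * norm (d (k n))" for n
    using d(2)[of "k n"] graphical_derivative_lipschitz_bound[OF U'(1,2) kU(2)] by (auto simp: P_def)
  moreover have "(\<lambda>n. L' * norm (d (k n))) \<longlonglongrightarrow> 0"
    using tendsto_mult_right_zero[OF tendsto_norm_zero[OF dlim]] .
  ultimately have ulim: "(\<lambda>n. v (s (k n)) + w (s (k n))) \<longlonglongrightarrow> 0"
    by (rule Lim_null_comparison[OF always_eventually[OF allI]])
  have vlim: "(\<lambda>n. v (s (k n))) \<longlonglongrightarrow> - \<zeta>"
    using tendsto_diff[OF ulim wlim] by simp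
  have plrz: "plr_at \<phi>1 z" using plr z\<Omega> by (simp add: plr_on_def)
  have vmem: "v (s (k n)) \<in> clarke_subdiff \<phi>1 (x (s (k n)))"
    and wmem: "w (s (k n)) \<in> clarke_subdiff ?f2 (x (s (k n)))" for n
    using d(2)[of "k n"] by (auto simp: P_def)
  note lim1 = plr_at_limit[OF plrz zfin xlim vlim vmem]
  have "\<zeta> \<in> clarke_subdiff ?f2 z"
    by (rule clarke_subdiff_lipschitz_closed[OF U xlim wlim wmem])
  with lim1(2) show "z \<in> stationary_set \<phi>1 \<phi>2"
    unfolding stationary_set_def mem_Collect_eq using set_plus_intro by fastforce
  have "isCont \<phi>2 z"
    using lipschitz_on_continuous_on[OF U(1)] U by (simp add: continuous_on_eq_continuous_at)
  then have "(\<lambda>n. ereal (\<phi>2 (x (s (k n))))) \<longlonglongrightarrow> ereal (\<phi>2 z)"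
    using isCont_tendsto_compose[OF _ xlim] by (intro tendsto_ereal) blast
  then have philim: "(\<lambda>n. \<phi>1 (x (s (k n))) + ereal (\<phi>2 (x (s (k n))))) \<longlonglongrightarrow> \<phi>1 z + ereal (\<phi>2 z)"
    by (intro tendsto_add_ereal lim1(1) zfin) auto
  have "(\<lambda>n. ext_infdist 0 (clarke_subdiff \<phi>1 (x (s (k n))) + clarke_subdiff ?f2 (x (s (k n))))) \<longlonglongrightarrow> 0"
    by (rule ext_infdist_zero_tendsto_zero[OF set_plus_intro[OF vmem wmem] ulim])
  with s(1) slim xlim d(1) dlim philim
  show "\<exists>(s :: nat \<Rightarrow> real) xdot. (\<forall>n. 0 \<le> s n) \<and> filterlim s at_top sequentially \<and>
      (\<lambda>n. x (s n)) \<longlonglongrightarrow> z \<and>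
      (\<forall>n. (x has_vector_derivative xdot n) (at (s n) within {0..})) \<and> xdot \<longlonglongrightarrow> 0 \<and>
      (\<lambda>n. \<phi>1 (x (s n)) + ereal (\<phi>2 (x (s n)))) \<longlonglongrightarrow> \<phi>1 z + ereal (\<phi>2 z) \<and>
      (\<lambda>n. ext_infdist 0 (clarke_subdiff \<phi>1 (x (s n))
             + clarke_subdiff (\<lambda>y. ereal (\<phi>2 y)) (x (s n)))) \<longlonglongrightarrow> 0"
    by (intro exI[of _ "\<lambda>n. s (k n)"] exI[of _ "\<lambda>n. d (k n)"] conjI allI) auto
qed

lemma is_solution_continuous_on:
  assumes "is_solution \<phi>1 \<phi>2 F x0 x"
  shows "continuous_on {0..} x"
  unfolding continuous_on_eq_continuous_within
proof
  fix t :: real assume t: "t \<in> {0..}"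
  have "continuous_on {0..t + 1} x"
    using assms t by (intro abs_continuous_imp_continuous_on) (auto simp: is_solution_def)
  then have "continuous (at t within {0..t + 1}) x"
    using t by (simp add: continuous_on_eq_continuous_within)
  moreover have "at t within {0..t + 1} = at t within {0..}"
    by (rule at_within_nhd[of t "{..<t + 1}"]) auto
  ultimately show "continuous (at t within {0..}) x" by simp
qed

theorem theorem4p2:
  fixes \<phi>1 :: "'a::euclidean_space \<Rightarrow> ereal" and \<phi>2 :: "'a \<Rightarrow> real" and \<phi> :: "'a \<Rightarrow> ereal"
    and F :: "'a \<Rightarrow> 'a" and x0 :: 'a and \<Omega> :: "'a set" and x :: "real \<Rightarrow> 'a"
  assumes "\<And>y. \<phi>1 y \<noteq> -\<infinity>"
    and "lsc_on UNIV \<phi>1"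
    and "lsc_on UNIV (\<lambda>y. ereal (\<phi>2 y))"
    and "\<phi> = (\<lambda>y. \<phi>1 y + ereal (\<phi>2 y))"
    and "x0 \<in> eff_dom \<phi>"
    and "open \<Omega>"
    and "{y. \<phi> y \<le> \<phi> x0} \<subseteq> \<Omega>"
    and "plr_on \<Omega> \<phi>1"
    and "locally_lipschitz_on \<Omega> \<phi>2"
    and "locally_lipschitz_on \<Omega> F"
    and "is_solution \<phi>1 \<phi>2 F x0 x"
  shows "(bounded (x ` {0..}) \<longrightarrow>
            omega_limit_set x \<noteq> {} \<and> compact (omega_limit_set x) \<and> connected (omega_limit_set x))
       \<and> (is_energetic_solution \<phi>1 \<phi>2 F x0 x \<longrightarrow>
            omega_limit_set x \<subseteq> stationary_set \<phi>1 \<phi>2 \<and>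
            (\<forall>xs \<in> omega_limit_set x.
               (\<exists>(s :: nat \<Rightarrow> real) xdot. (\<forall>n. 0 \<le> s n) \<and> filterlim s at_top sequentially \<and>
                  (\<lambda>n. x (s n)) \<longlonglongrightarrow> xs \<and>
                  (\<forall>n. (x has_vector_derivative xdot n) (at (s n) within {0..})) \<and> xdot \<longlonglongrightarrow> 0 \<and>
                  (\<lambda>n. \<phi> (x (s n))) \<longlonglongrightarrow> \<phi> xs \<and>
                  (\<lambda>n. ext_infdist 0 (clarke_subdiff \<phi>1 (x (s n))
                         + clarke_subdiff (\<lambda>y. ereal (\<phi>2 y)) (x (s n)))) \<longlonglongrightarrow> 0) \<and>
               (xs isolated_in omega_limit_set x \<longrightarrow> (x \<longlongrightarrow> xs) at_top)))"
proof (intro conjI impI ballI subsetI)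
  have cont: "continuous_on {0..} x" using assms(11) by (rule is_solution_continuous_on)
  {
    assume "bounded (x ` {0..})"
    from omega_limit_set_bounded[OF this cont]
    show "omega_limit_set x \<noteq> {}" "compact (omega_limit_set x)" "connected (omega_limit_set x)" .
  }
  {
    fix z assume "z isolated_in omega_limit_set x"
    then show "(x \<longlongrightarrow> z) at_top" by (rule isolated_in_omega_limit_set_tendsto[OF cont])
  }
  assume sol: "is_energetic_solution \<phi>1 \<phi>2 F x0 x"
  have "\<phi>1 x0 < \<infinity>" using assms(4,5) by (cases "\<phi>1 x0") (auto simp: eff_dom_def)
  note * = energetic_omega_limit[OF assms(1-3) this assms(6) assms(7)[unfolded assms(4)] assms(8-10) sol,
      folded fun_cong[OF assms(4)]]
  {
    fix z assume "z \<in> omega_limit_set x"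
    then show "z \<in> stationary_set \<phi>1 \<phi>2" by (rule *(1))
  next
    fix z assume "z \<in> omega_limit_set x"
    then show "\<exists>(s :: nat \<Rightarrow> real) xdot. (\<forall>n. 0 \<le> s n) \<and> filterlim s at_top sequentially \<and>
        (\<lambda>n. x (s n)) \<longlonglongrightarrow> z \<and>
        (\<forall>n. (x has_vector_derivative xdot n) (at (s n) within {0..})) \<and> xdot \<longlonglongrightarrow> 0 \<and>
        (\<lambda>n. \<phi> (x (s n))) \<longlonglongrightarrow> \<phi> z \<and>
        (\<lambda>n. ext_infdist 0 (clarke_subdiff \<phi>1 (x (s n))
               + clarke_subdiff (\<lambda>y. ereal (\<phi>2 y)) (x (s n)))) \<longlonglongrightarrow> 0"
      by (rule *(2))
  }
qed

end
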